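(* Let $\epsilon>0$. Then there is a $D=D(\epsilon)$ such that the following holds for all $t>d>D$. Let $\vec\sigma$ be a weight vector (of any length $r$) with all $\sigma_i>\epsilon$, and let $\mathbf{D}$ be a symmetric $r\times r$ matrix with entries in $[-\infty,1]$ such that $\gamma(\vec\sigma,\mathbf{D})\geq\epsilon$. Then all but at most a $2^{-t}$ proportion of the elements $H\in\mathcal{D}(\vec\sigma,\mathbf{D})(t,d)$ satisfy $c(H)\geq(\alpha-\epsilon)\,\gamma(\vec\sigma,\mathbf{D})\,t\sqrt{\log d}$.
   Context: Graphs are finite and simple; $|G|$, $e(G)$ are the numbers of vertices and edges; $\log$ is natural; $t$ is a positive integer and $d>1$. A graph $H$ is a minor of $G$ if there are disjoint non-empty sets $(V_h)_{h\in V(H)}$ of vertices of $G$, each inducing a connected subgraph, such that for every edge $hh'$ of $H$ there is an edge of $G$ between $V_h$ and $V_{h'}$. Define $c(H)=\inf\{c:\text{every graph }G\text{ with }e(G)/|G|\geq c\text{ contains }H\text{ as a minor}\}$. The constant $\alpha=\max_{0<p<1}\frac{p}{2\sqrt{\log(1/(1-p))}}=0.319\ldots$. $[-\infty,1]$ is the set of real numbers at most $1$ together with a formal symbol $-\infty$ smaller than all reals, with $d^{-\infty}=0$ for $d>1$. A weight vector of length $r$ is $\vec\sigma=(\sigma_1,\dots,\sigma_r)\in\mathbb{R}_{\geq0}^r$ with $\sum_i\sigma_i=1$. For a symmetric matrix $\mathbf{D}=(D_{ij})_{i,j=1}^r$ with entries in $[-\infty,1]$ define $$\gamma(\vec\sigma,\mathbf{D})=\min\Big\{\sum_i\sigma_i\beta_i:\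 \beta\in\mathbb{R}_{\geq0}^r,\ \beta_i\beta_j\geq D_{ij}\text{ for all }1\leq i,j\leq r\Big\}.$$ The class $\mathcal{D}(\vec\sigma,\mathbf{D})(t,d)$ consists of all graphs with vertex set $\{1,\dots,t\}$ with the following property. Let $s_i=\lfloor\sigma_it\rfloor$ for $i\leq i_0$ and $s_i=\lceil\sigma_it\rceil$ for $i>i_0$, where $i_0$ is chosen so that $\sum_is_i=t$; let $S_1=\{1,\dots,s_1\}$, $S_2=\{s_1+1,\dots,s_1+s_2\}$, and so on. Then for all $i\leq j$ the graph has exactly $\lfloor td^{D_{ij}}\rfloor$ edges between $S_i$ and $S_j$ (edges inside $S_i$ if $i=j$). *)

theory Defs
  imports "HOL-Analysis.Analysis"
begin

type_synonym 'a graph = "'a set \<times> 'a set set"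

abbreviation verts :: "'a graph \<Rightarrow> 'a set" where "verts G \<equiv> fst G"
abbreviation edges :: "'a graph \<Rightarrow> 'a set set" where "edges G \<equiv> snd G"

definition simple_graph :: "'a graph \<Rightarrow> bool" where
  "simple_graph G \<longleftrightarrow>
     finite (verts G) \<and> edges G \<subseteq> {{u, v} | u v. u \<in> verts G \<and> v \<in> verts G \<and> u \<noteq> v}"

definition induces_connected :: "'a graph \<Rightarrow> 'a set \<Rightarrow> bool" where
  "induces_connected G X \<longleftrightarrow>
     (\<forall>u\<in>X. \<forall>v\<in>X. (u, v) \<in> {(x, y). x \<in> X \<and> y \<in> X \<and> {x, y} \<in> edges G}\<^sup>*)"

definition is_minor :: "'b graph \<Rightarrow> 'a graph \<Rightarrow> bool" where
  "is_minor H G \<longleftrightarrow>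
     (\<exists>B :: 'b \<Rightarrow> 'a set.
        (\<forall>h\<in>verts H. B h \<noteq> {} \<and> B h \<subseteq> verts G \<and> induces_connected G (B h)) \<and>
        (\<forall>h\<in>verts H. \<forall>h'\<in>verts H. h \<noteq> h' \<longrightarrow> B h \<inter> B h' = {}) \<and>
        (\<forall>h\<in>verts H. \<forall>h'\<in>verts H. {h, h'} \<in> edges H \<longrightarrow>
           (\<exists>u\<in>B h. \<exists>v\<in>B h'. {u, v} \<in> edges G)))"

text \<open>
  Every finite graph has an isomorphic copy on a set of natural numbers, so quantifying over host
  graphs with vertices in \<^typ>\<open>nat\<close> loses nothing.  Hosts are non-empty, as the density
  \<open>e(G)/|G|\<close> requires.  The infimum is taken in the extended reals, so that no unspecified value
  arises when \<open>H\<close> has at most one vertex (where every real \<open>c\<close> qualifies).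
\<close>

definition minor_threshold :: "'b graph \<Rightarrow> ereal" where
  "minor_threshold H =
     Inf (ereal ` {c :: real. \<forall>G :: nat graph. simple_graph G \<and> verts G \<noteq> {} \<and>
            real (card (edges G)) / real (card (verts G)) \<ge> c \<longrightarrow> is_minor H G})"

text \<open>The maximum is attained in the interior, so the supremum is the maximum.\<close>

definition alpha_const :: real where
  "alpha_const = (SUP p\<in>{0<..<1::real}. p / (2 * sqrt (ln (1 / (1 - p)))))"

text \<open>
  Vectors of length \<open>r\<close> and \<open>r \<times> r\<close> matrices are functions of which only the values at the
  indices \<open>1, \<dots>, r\<close> matter.  Entries in \<open>[-\<infinity>, 1]\<close> are extended reals that are at most \<open>1\<close>.
\<close>

definition weight_vector :: "nat \<Rightarrow> (nat \<Rightarrow> real) \<Rightarrow> bool" where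
  "weight_vector r \<sigma> \<longleftrightarrow> (\<forall>i\<in>{1..r}. 0 \<le> \<sigma> i) \<and> (\<Sum>i=1..r. \<sigma> i) = 1"

definition exponent_matrix :: "nat \<Rightarrow> (nat \<Rightarrow> nat \<Rightarrow> ereal) \<Rightarrow> bool" where
  "exponent_matrix r D \<longleftrightarrow> (\<forall>i\<in>{1..r}. \<forall>j\<in>{1..r}. D i j \<le> 1 \<and> D i j = D j i)"

text \<open>
  The infimum is over a non-empty set (\<open>\<beta> = 1\<close> is admissible when all entries are at most \<open>1\<close>) that
  is bounded below by \<open>0\<close>; when all weights are positive it is attained, by compactness, and hence
  is the minimum.
\<close>

definition gamma_weight :: "nat \<Rightarrow> (nat \<Rightarrow> real) \<Rightarrow> (nat \<Rightarrow> nat \<Rightarrow> ereal) \<Rightarrow> real" where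
  "gamma_weight r \<sigma> D =
     Inf {(\<Sum>i=1..r. \<sigma> i * \<beta> i) | \<beta> :: nat \<Rightarrow> real.
            (\<forall>i\<in>{1..r}. 0 \<le> \<beta> i) \<and> (\<forall>i\<in>{1..r}. \<forall>j\<in>{1..r}. D i j \<le> ereal (\<beta> i * \<beta> j))}"

definition epowr :: "real \<Rightarrow> ereal \<Rightarrow> real" where
  "epowr d x = (if x = -\<infinity> then 0 else d powr real_of_ereal x)"

definition rounded_size :: "(nat \<Rightarrow> real) \<Rightarrow> nat \<Rightarrow> nat \<Rightarrow> nat \<Rightarrow> nat" where
  "rounded_size \<sigma> t i\<^sub>0 i =
     (if i \<le> i\<^sub>0 then nat \<lfloor>\<sigma> i * real t\<rfloor> else nat \<lceil>\<sigma> i * real t\<rceil>)"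

text \<open>
  A suitable \<open>i\<^sub>0\<close> exists (lemma \<open>ex_rounding_index\<close>), and if several are suitable then they all
  yield the same sizes, because each rounded size is non-increasing in \<open>i\<^sub>0\<close>.
\<close>

definition part_size :: "nat \<Rightarrow> (nat \<Rightarrow> real) \<Rightarrow> nat \<Rightarrow> nat \<Rightarrow> nat" where
  "part_size r \<sigma> t =
     rounded_size \<sigma> t (SOME i\<^sub>0. i\<^sub>0 \<le> r \<and> (\<Sum>i=1..r. rounded_size \<sigma> t i\<^sub>0 i) = t)"

lemma ex_rounding_index:
  assumes "weight_vector r \<sigma>"
  shows "\<exists>i\<^sub>0\<le>r. (\<Sum>i=1..r. rounded_size \<sigma> t i\<^sub>0 i) = t"
proof -
  define f where "f k = (\<Sum>i=1..r. rounded_size \<sigma> t (r - k) i)" for k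
  have tot: "(\<Sum>i=1..r. \<sigma> i * real t) = real t"
    using assms by (simp add: weight_vector_def flip: sum_distrib_right)
  have nonneg: "0 \<le> \<sigma> i * real t" if "i \<in> {1..r}" for i
    using assms that by (simp add: weight_vector_def)
  have "real (f 0) \<le> (\<Sum>i=1..r. \<sigma> i * real t)"
    unfolding f_def of_nat_sum
    by (rule sum_mono) (use nonneg in \<open>auto simp: rounded_size_def\<close>)
  hence lo: "int (f 0) \<le> int t" using tot by linarith
  have "(\<Sum>i=1..r. \<sigma> i * real t) \<le> real (f r)"
    unfolding f_def of_nat_sum
    by (rule sum_mono) (auto simp: rounded_size_def real_nat_ceiling_ge)
  hence hi: "int t \<le> int (f r)" using tot by linarith
  have step: "\<bar>int (f (k + 1)) - int (f k)\<bar> \<le> 1" if "k < r" for k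
  proof -
    let ?m = "r - k"
    have m: "?m \<in> {1..r}" "r - (k + 1) = ?m - 1" using that by auto
    have "(\<Sum>i\<in>{1..r} - {?m}. rounded_size \<sigma> t (?m - 1) i) =
          (\<Sum>i\<in>{1..r} - {?m}. rounded_size \<sigma> t ?m i)"
      by (rule sum.cong) (auto simp: rounded_size_def)
    hence "int (f (k + 1)) - int (f k) =
           int (rounded_size \<sigma> t (?m - 1) ?m) - int (rounded_size \<sigma> t ?m ?m)"
      unfolding f_def m(2) sum.remove[OF finite_atLeastAtMost m(1)] by simp
    also have "\<dots> = \<lceil>\<sigma> ?m * real t\<rceil> - \<lfloor>\<sigma> ?m * real t\<rfloor>"
    proof -
      have "0 \<le> \<lfloor>\<sigma> ?m * real t\<rfloor>" "0 \<le> \<lceil>\<sigma> ?m * real t\<rceil>" using nonneg[OF m(1)] by linarith+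
      moreover have "\<not> ?m \<le> ?m - 1" using m(1) by auto
      ultimately show ?thesis by (simp add: rounded_size_def)
    qed
    finally show ?thesis by linarith
  qed
  have "\<exists>k\<le>r. int (f k) = int t"
    using nat0_intermed_int_val[of r "\<lambda>k. int (f k)" "int t"] step lo hi by auto
  then obtain k where "k \<le> r" "f k = t" by auto
  thus ?thesis unfolding f_def by (intro exI[of _ "r - k"]) auto
qed

definition part :: "nat \<Rightarrow> (nat \<Rightarrow> real) \<Rightarrow> nat \<Rightarrow> nat \<Rightarrow> nat set" where
  "part r \<sigma> t i = {(\<Sum>k=1..<i. part_size r \<sigma> t k) + 1 .. (\<Sum>k=1..i. part_size r \<sigma> t k)}"

text \<open>In a simple graph, \<open>edges_between G S S\<close> is the set of edges inside \<open>S\<close>.\<close>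

definition edges_between :: "'a graph \<Rightarrow> 'a set \<Rightarrow> 'a set \<Rightarrow> 'a set set" where
  "edges_between G S T = {e \<in> edges G. \<exists>u\<in>S. \<exists>v\<in>T. e = {u, v}}"

definition graph_class ::
  "nat \<Rightarrow> (nat \<Rightarrow> real) \<Rightarrow> (nat \<Rightarrow> nat \<Rightarrow> ereal) \<Rightarrow> nat \<Rightarrow> real \<Rightarrow> nat graph set" where
  "graph_class r \<sigma> D t d =
     {H. simple_graph H \<and> verts H = {1..t} \<and>
         (\<forall>i\<in>{1..r}. \<forall>j\<in>{i..r}.
            int (card (edges_between H (part r \<sigma> t i) (part r \<sigma> t j)))
              = \<lfloor>real t * epowr d (D i j)\<rfloor>)}"

end

theory Submission
  imports Defs "HOL-Real_Asymp.Real_Asymp"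
begin

text \<open>
  The host is a blow-up: take a random graph of density \<open>p\<close> on \<open>N\<close> vertices, with \<open>N\<close> a power of \<open>d\<close>
  slightly below \<open>d\<close> and \<open>p\<close> nearly optimal for \<open>\<alpha>\<close>, and replace every vertex by \<open>k\<close> independent
  copies so that there are about \<open>\<gamma> t L\<close> vertices, where \<open>L\<^sup>2 = log d / log (1 / (1 - p))\<close>.  Suppose
  that \<open>H\<close> is a minor and let \<open>\<beta>\<^sub>i L\<close> be slightly more than the average size of the branch sets of the
  vertices in \<open>S\<^sub>i\<close>.  Then \<open>\<Sum> \<sigma>\<^sub>i \<beta>\<^sub>i\<close> is smaller than \<open>\<gamma>\<close> by a margin, so some \<open>D\<^sub>i\<^sub>j\<close> exceeds
  \<open>\<beta>\<^sub>i \<beta>\<^sub>j\<close> by a constant \<open>e\<close>.  Two typical branch sets for \<open>S\<^sub>i\<close> and \<open>S\<^sub>j\<close> are non-adjacent with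
  frequency about \<open>(1 - p) ^ (\<beta>\<^sub>i \<beta>\<^sub>j L\<^sup>2)\<close>, that is at least \<open>d ^ (e - D\<^sub>i\<^sub>j)\<close>, and the \<open>t d ^ D\<^sub>i\<^sub>j\<close>
  random edges of \<open>H\<close> between \<open>S\<^sub>i\<close> and \<open>S\<^sub>j\<close> must avoid all such pairs, which has probability at most
  about \<open>exp (- t d ^ e)\<close>.  Only the projections of the branch sets to the \<open>N\<close> base vertices matter;
  there are \<open>exp (t polylog d)\<close> families of these, so the union bound succeeds.
\<close>

section \<open>Weighted random subsets\<close>

text \<open>The probability that a random subset of \<open>\<Omega>\<close>, containing each element
  independently with probability \<open>p\<close>, equals \<open>F\<close>. Probabilities are
  handled as sums of these weights over finite families.\<close>

definition bernoulli_weight :: "real \<Rightarrow> 'a set \<Rightarrow> 'a set \<Rightarrow> real" where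
  "bernoulli_weight p \<Omega> F = p ^ card F * (1 - p) ^ card (\<Omega> - F)"

lemma bernoulli_weight_nonneg: "0 \<le> p \<Longrightarrow> p \<le> 1 \<Longrightarrow> 0 \<le> bernoulli_weight p \<Omega> F"
  by (simp add: bernoulli_weight_def)

lemma sum_bernoulli_weight:
  assumes "finite \<Omega>"
  shows "(\<Sum>F\<in>Pow \<Omega>. bernoulli_weight p \<Omega> F) = 1"
  using prod_add[OF assms, of "\<lambda>_. p" "\<lambda>_. 1 - p"] by (simp add: bernoulli_weight_def)

text \<open>Independence of the random set inside and outside \<open>B\<close>; both factors are
  again weights of the same kind, which suits an induction.\<close>

lemma bernoulli_weight_Un:
  assumes "finite \<Omega>" "A \<subseteq> B" "B \<subseteq> \<Omega>" "C \<subseteq> \<Omega> - B"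
  shows "bernoulli_weight p \<Omega> (A \<union> C) = bernoulli_weight p B A * bernoulli_weight p (\<Omega> - B) C"
proof -
  have fin: "finite A" "finite B" "finite C"
    using assms by (auto intro: finite_subset)
  have "card (A \<union> C) = card A + card C"
    by (rule card_Un_disjoint) (use fin assms in auto)
  moreover have "\<Omega> - (A \<union> C) = (B - A) \<union> (\<Omega> - B - C)"
    using assms by auto
  moreover have "card ((B - A) \<union> (\<Omega> - B - C)) = card (B - A) + card (\<Omega> - B - C)"
    by (rule card_Un_disjoint) (use fin assms in auto)
  ultimately show ?thesis
    by (simp add: bernoulli_weight_def power_add)
qed

text \<open>Disjoint blocks are hit independently, and \<open>B i\<close> is missed with probability
  \<open>(1 - p) ^ card (B i)\<close>. The induction splits \<open>F\<close> into its trace on one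
  block and the rest, leaving the same problem on \<open>\<Omega> - B i\<close>.\<close>

lemma sum_bernoulli_weight_hitting:
  assumes "finite I" "finite \<Omega>" "\<And>i. i \<in> I \<Longrightarrow> B i \<subseteq> \<Omega>" "disjoint_family_on B I"
  shows "(\<Sum>F | F \<subseteq> \<Omega> \<and> (\<forall>i\<in>I. F \<inter> B i \<noteq> {}). bernoulli_weight p \<Omega> F) =
         (\<Prod>i\<in>I. 1 - (1 - p) ^ card (B i))"
  using assms
proof (induction I arbitrary: \<Omega> rule: finite_induct)
  case empty
  then show ?case using sum_bernoulli_weight[of \<Omega> p] by (simp add: Pow_def)
next
  case (insert i I)
  let ?w = "bernoulli_weight p" and ?\<Omega> = "\<Omega> - B i"
  let ?P = "{A. A \<subseteq> B i \<and> A \<noteq> {}}" and ?Q = "{C. C \<subseteq> ?\<Omega> \<and> (\<forall>j\<in>I. C \<inter> B j \<noteq> {})}"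
  have Bi: "B i \<subseteq> \<Omega>" "finite (B i)"
    using insert.prems by (auto intro: finite_subset)
  have disj: "B j \<inter> B i = {}" if "j \<in> I" for j
    using insert.prems(3) insert.hyps that by (auto dest: disjoint_family_onD)
  have hit: "(A \<union> C) \<inter> B j = C \<inter> B j" if "A \<subseteq> B i" "j \<in> I" for A C j
    using disj[OF that(2)] that(1) by blast
  have split: "F = (F \<inter> B i) \<union> (F - B i)" for F by blast
  have eq: "{F. F \<subseteq> \<Omega> \<and> (\<forall>j\<in>insert i I. F \<inter> B j \<noteq> {})} = (\<lambda>(A, C). A \<union> C) ` (?P \<times> ?Q)"
  proof (intro equalityI subsetI)
    fix F assume F: "F \<in> {F. F \<subseteq> \<Omega> \<and> (\<forall>j\<in>insert i I. F \<inter> B j \<noteq> {})}"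
    have "(F \<inter> B i, F - B i) \<in> ?P \<times> ?Q"
      using F disj by blast
    then show "F \<in> (\<lambda>(A, C). A \<union> C) ` (?P \<times> ?Q)"
      using split[of F] by (metis (no_types, lifting) case_prod_conv image_eqI)
  next
    fix F assume "F \<in> (\<lambda>(A, C). A \<union> C) ` (?P \<times> ?Q)"
    then obtain A C where AC: "A \<in> ?P" "C \<in> ?Q" "F = A \<union> C" by auto
    have "F \<inter> B i \<noteq> {}" using AC by blast
    moreover have "F \<inter> B j \<noteq> {}" if "j \<in> I" for j
      using hit[of A j C] that AC by auto
    moreover have "F \<subseteq> \<Omega>" using AC Bi by blast
    ultimately show "F \<in> {F. F \<subseteq> \<Omega> \<and> (\<forall>j\<in>insert i I. F \<inter> B j \<noteq> {})}" by blast
  qed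
  have inj: "inj_on (\<lambda>(A, C). A \<union> C) (?P \<times> ?Q)"
  proof (rule inj_onI, clarify)
    fix A C A' C'
    assume "A \<subseteq> B i" "A' \<subseteq> B i" "C \<subseteq> ?\<Omega>" "C' \<subseteq> ?\<Omega>" "A \<union> C = A' \<union> C'"
    then show "A = A' \<and> C = C'" by blast
  qed
  have finP: "finite (Pow (B i))" using Bi by simp
  have "(\<Sum>A\<in>?P. ?w (B i) A) = (\<Sum>A\<in>Pow (B i) - {{}}. ?w (B i) A)"
    by (rule sum.cong) auto
  also have "\<dots> = 1 - (1 - p) ^ card (B i)"
    using sum_bernoulli_weight[OF Bi(2), of p] sum.remove[OF finP, of "{}" "?w (B i)"]
    by (simp add: bernoulli_weight_def)
  finally have P: "(\<Sum>A\<in>?P. ?w (B i) A) = 1 - (1 - p) ^ card (B i)" .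
  have Q: "(\<Sum>C\<in>?Q. ?w ?\<Omega> C) = (\<Prod>j\<in>I. 1 - (1 - p) ^ card (B j))"
  proof (rule insert.IH)
    show "finite ?\<Omega>" using insert.prems by simp
    show "B j \<subseteq> ?\<Omega>" if "j \<in> I" for j
      using disj[OF that] insert.prems(2)[of j] that by auto
    show "disjoint_family_on B I"
      using insert.prems(3) by (auto simp: disjoint_family_on_def)
  qed
  have "(\<Sum>F | F \<subseteq> \<Omega> \<and> (\<forall>j\<in>insert i I. F \<inter> B j \<noteq> {}). ?w \<Omega> F) =
        (\<Sum>(A, C)\<in>?P \<times> ?Q. ?w \<Omega> (A \<union> C))"
    unfolding eq sum.reindex[OF inj] by (simp add: case_prod_unfold)
  also have "\<dots> = (\<Sum>(A, C)\<in>?P \<times> ?Q. ?w (B i) A * ?w ?\<Omega> C)"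
    by (rule sum.cong) (use bernoulli_weight_Un[OF insert.prems(1) _ Bi(1)] in auto)
  also have "\<dots> = (\<Sum>A\<in>?P. ?w (B i) A) * (\<Sum>C\<in>?Q. ?w ?\<Omega> C)"
    by (simp add: sum_product sum.cartesian_product)
  also have "\<dots> = (\<Prod>j\<in>insert i I. 1 - (1 - p) ^ card (B j))"
    unfolding P Q using insert.hyps by simp
  finally show ?case .
qed

text \<open>Linearity of expectation; the probability of a single element is the hitting formula for
  the one block \<open>{e}\<close>.\<close>

lemma sum_bernoulli_weight_card:
  assumes "finite \<Omega>"
  shows "(\<Sum>F\<in>Pow \<Omega>. bernoulli_weight p \<Omega> F * real (card F)) = p * real (card \<Omega>)"
proof -
  let ?w = "bernoulli_weight p \<Omega>"
  have "(\<Sum>F\<in>Pow \<Omega>. ?w F * real (card F)) = (\<Sum>F\<in>Pow \<Omega>. \<Sum>e\<in>\<Omega>. if e \<in> F then ?w F else 0)"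
  proof (rule sum.cong)
    fix F assume "F \<in> Pow \<Omega>"
    then have "\<Omega> \<inter> {e. e \<in> F} = F" by auto
    then show "?w F * real (card F) = (\<Sum>e\<in>\<Omega>. if e \<in> F then ?w F else 0)"
      using sum.inter_filter[OF assms, of "\<lambda>_. ?w F" "\<lambda>e. e \<in> F"]
      by (simp add: Int_def mult.commute)
  qed simp
  also have "\<dots> = (\<Sum>e\<in>\<Omega>. \<Sum>F\<in>Pow \<Omega>. if e \<in> F then ?w F else 0)"
    by (rule sum.swap)
  also have "\<dots> = (\<Sum>e\<in>\<Omega>. p)"
  proof (rule sum.cong)
    fix e assume e: "e \<in> \<Omega>"
    have "(\<Sum>F\<in>Pow \<Omega>. if e \<in> F then ?w F else 0) = (\<Sum>F | F \<in> Pow \<Omega> \<and> e \<in> F. ?w F)"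
      using sum.inter_filter[of "Pow \<Omega>" ?w "\<lambda>F. e \<in> F"] assms by simp
    also have "\<dots> = (\<Sum>F | F \<subseteq> \<Omega> \<and> (\<forall>i\<in>{()}. F \<inter> {e} \<noteq> {}). ?w F)"
      by (rule sum.cong) auto
    also have "\<dots> = p"
      using sum_bernoulli_weight_hitting[of "{()}" \<Omega> "\<lambda>_. {e}" p] assms e
      by (simp add: disjoint_family_on_def)
    finally show "(\<Sum>F\<in>Pow \<Omega>. if e \<in> F then ?w F else 0) = p" .
  qed simp
  finally show ?thesis by simp
qed

text \<open>A set with at most \<open>s\<close> elements can be listed in \<open>s\<close> slots,
  each holding an element of \<open>V\<close> or the blank \<open>None\<close>.\<close>

lemma card_small_subsets_le:
  assumes "finite V"
  shows "card {A. A \<subseteq> V \<and> card A \<le> s} \<le> (card V + 1) ^ s"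
proof -
  let ?W = "insert None (Some ` V)" and ?\<Phi> = "\<lambda>f. {v. Some v \<in> f ` {..<s}}"
  have "{A. A \<subseteq> V \<and> card A \<le> s} \<subseteq> ?\<Phi> ` (PiE {..<s} (\<lambda>_. ?W))"
  proof clarify
    fix A assume A: "A \<subseteq> V" "card A \<le> s"
    then have "finite A" using assms by (auto intro: finite_subset)
    from ex_bij_betw_nat_finite[OF this] obtain h where h: "bij_betw h {0..<card A} A" by blast
    define f where "f = restrict (\<lambda>i. if i < card A then Some (h i) else None) {..<s}"
    have img: "h ` {0..<card A} = A" using h by (simp add: bij_betw_def)
    have "?\<Phi> f = A"
    proof (intro equalityI subsetI)
      fix v assume "v \<in> ?\<Phi> f"
      then show "v \<in> A" using img by (auto simp: f_def split: if_splits)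
    next
      fix v assume "v \<in> A"
      then obtain i where "i < card A" "v = h i" using img by force
      then show "v \<in> ?\<Phi> f" using A(2) by (auto simp: f_def intro!: image_eqI[of _ _ i])
    qed
    moreover have "f \<in> PiE {..<s} (\<lambda>_. ?W)"
    proof -
      have "h i \<in> V" if "i < card A" for i
        using img A(1) that by force
      then show ?thesis by (auto simp: f_def)
    qed
    ultimately show "A \<in> ?\<Phi> ` (PiE {..<s} (\<lambda>_. ?W))" by blast
  qed
  then have "card {A. A \<subseteq> V \<and> card A \<le> s} \<le> card (PiE {..<s} (\<lambda>_. ?W))"
    using assms by (intro surj_card_le finite_PiE) auto
  also have "\<dots> = card ?W ^ s" by (simp add: card_PiE)
  also have "card ?W = card V + 1"
    using assms by (subst card_insert_disjoint) (auto simp: card_image)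
  finally show ?thesis .
qed

section \<open>A random graph with well spread non-edges\<close>

lemma sum_UN_le:
  fixes f :: "'a \<Rightarrow> real"
  assumes "finite I" "\<And>i. i \<in> I \<Longrightarrow> finite (A i)" "\<And>x. 0 \<le> f x"
  shows "sum f (\<Union>i\<in>I. A i) \<le> (\<Sum>i\<in>I. sum f (A i))"
  using assms(1,2)
proof (induction I rule: finite_induct)
  case (insert i I)
  have "sum f (A i \<union> (\<Union>j\<in>I. A j)) + sum f (A i \<inter> (\<Union>j\<in>I. A j)) =
        sum f (A i) + sum f (\<Union>j\<in>I. A j)"
    by (rule sum.union_inter) (use insert in auto)
  moreover have "0 \<le> sum f (A i \<inter> (\<Union>j\<in>I. A j))"
    by (rule sum_nonneg) (rule assms(3))
  ultimately show ?case using insert by simp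
qed simp

section \<open>Unordered pairs and separated families of small sets\<close>

definition pairs_between :: "'a set \<Rightarrow> 'a set \<Rightarrow> 'a set set" where
  "pairs_between S T = {{u, v} | u v. u \<in> S \<and> v \<in> T \<and> u \<noteq> v}"

lemma finite_pairs_between: "finite S \<Longrightarrow> finite T \<Longrightarrow> finite (pairs_between S T)"
  by (rule finite_subset[of _ "(\<lambda>(u, v). {u, v}) ` (S \<times> T)"]) (auto simp: pairs_between_def)

lemma card_pairs_between_disjoint:
  assumes "S \<inter> T = {}"
  shows "card (pairs_between S T) = card S * card T"
proof -
  have "pairs_between S T = (\<lambda>(u, v). {u, v}) ` (S \<times> T)"
    using assms by (fastforce simp: pairs_between_def)
  moreover have "inj_on (\<lambda>(u, v). {u, v}) (S \<times> T)"
    using assms by (fastforce simp: inj_on_def doubleton_eq_iff)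
  ultimately show ?thesis by (simp add: card_image card_cartesian_product)
qed

lemma card_pairs_between_same:
  assumes "finite V"
  shows "card (pairs_between V V) = card V choose 2"
proof -
  have "pairs_between V V = {e. e \<subseteq> V \<and> card e = 2}"
    by (fastforce simp: pairs_between_def card_2_iff)
  then show ?thesis using n_subsets[OF assms] by simp
qed

definition anticomplete :: "'a set set \<Rightarrow> 'a set \<Rightarrow> 'a set \<Rightarrow> bool" where
  "anticomplete E X Y \<longleftrightarrow> (\<forall>x\<in>X. \<forall>y\<in>Y. {x, y} \<notin> E)"

definition small_sets :: "'a set \<Rightarrow> nat \<Rightarrow> 'a set set" where
  "small_sets V s = {A. A \<subseteq> V \<and> A \<noteq> {} \<and> card A \<le> s}"

definition disjoint_systems :: "'a set \<Rightarrow> nat \<Rightarrow> nat \<Rightarrow> (nat \<Rightarrow> 'a set) \<Rightarrow> (nat \<Rightarrow> 'a set) \<Rightarrow> bool" where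
  "disjoint_systems V s m X Y \<longleftrightarrow>
     (\<forall>i<m. X i \<in> small_sets V s) \<and> (\<forall>i<m. Y i \<in> small_sets V s) \<and>
     disjoint_family_on X {..<m} \<and> disjoint_family_on Y {..<m} \<and> (\<forall>i<m. \<forall>j<m. X i \<inter> Y j = {})"

text \<open>
  Asking for one non-adjacent pair among \<open>m \<times> m\<close> sets, rather than for the expected number of them,
  costs only a factor of order \<open>K\<close>: it forces density about \<open>1 / m\<close> between any two large families
  of small sets, and \<open>m\<close> can be taken close to \<open>K / q ^ (card X * card Y)\<close>.
\<close>

definition spreads_nonedges :: "'a set \<Rightarrow> nat \<Rightarrow> real \<Rightarrow> real \<Rightarrow> 'a set set \<Rightarrow> bool" where
  "spreads_nonedges V s q K E \<longleftrightarrow>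
     (\<forall>m X Y. 0 < m \<longrightarrow> disjoint_systems V s m X Y \<longrightarrow>
        (\<forall>i<m. \<forall>j<m. K \<le> real m * q ^ (card (X i) * card (Y j))) \<longrightarrow>
        (\<exists>i<m. \<exists>j<m. anticomplete E (X i) (Y j)))"

text \<open>The \<open>m * m\<close> blocks of pairs between \<open>X i\<close> and
  \<open>Y j\<close> are disjoint, hence hit independently. Each is missed with probability at least
  \<open>K / m\<close>, and \<open>(1 - K / m) ^ (m * m)\<close> is at most
  \<open>exp (- K * m)\<close>.\<close>

lemma weight_no_anticomplete_pair_le:
  assumes p: "0 < p" "p < 1" and V: "finite V" and m: "0 < m"
    and XY: "disjoint_systems V s m X Y"
    and K: "\<And>i j. i < m \<Longrightarrow> j < m \<Longrightarrow> K \<le> real m * (1 - p) ^ (card (X i) * card (Y j))"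
  shows "(\<Sum>F | F \<subseteq> pairs_between V V \<and> (\<forall>i<m. \<forall>j<m. \<not> anticomplete F (X i) (Y j)).
            bernoulli_weight p (pairs_between V V) F) \<le> exp (- K * real m)"
proof -
  let ?\<Omega> = "pairs_between V V" and ?I = "{..<m} \<times> {..<m}"
  define B where "B = (\<lambda>(i, j). pairs_between (X i) (Y j))"
  have sub: "X i \<subseteq> V" "Y i \<subseteq> V" if "i < m" for i
    using XY that by (auto simp: disjoint_systems_def small_sets_def)
  have dXY: "X i \<inter> Y j = {}" if "i < m" "j < m" for i j
    using XY that by (auto simp: disjoint_systems_def)
  have dX: "X i \<inter> X j = {}" and dY: "Y i \<inter> Y j = {}" if "i < m" "j < m" "i \<noteq> j" for i j
    using XY that unfolding disjoint_systems_def disjoint_family_on_def by auto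
  have disj: "disjoint_family_on B ?I"
  unfolding disjoint_family_on_def
  proof (intro ballI impI)
    fix a b assume ab: "a \<in> ?I" "b \<in> ?I" "a \<noteq> b"
    obtain i j i' j' where [simp]: "a = (i, j)" "b = (i', j')" by (cases a, cases b)
    have lt: "i < m" "j < m" "i' < m" "j' < m" and ne: "i \<noteq> i' \<or> j \<noteq> j'" using ab by auto
    show "B a \<inter> B b = {}"
    proof (rule ccontr)
      assume "B a \<inter> B b \<noteq> {}"
      then obtain x y x' y' where xy: "x \<in> X i" "y \<in> Y j" "x' \<in> X i'" "y' \<in> Y j'" "{x, y} = {x', y'}"
        by (auto simp: B_def pairs_between_def)
      have "x \<noteq> y'" using dXY[of i j'] xy lt by auto
      then have "x = x'" "y = y'" using xy(5) by (auto simp: doubleton_eq_iff)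
      then show False using ne dX[of i i'] dY[of j j'] lt xy by auto
    qed
  qed
  have eq: "(\<forall>i<m. \<forall>j<m. \<not> anticomplete F (X i) (Y j)) \<longleftrightarrow> (\<forall>a\<in>?I. F \<inter> B a \<noteq> {})" for F
  proof -
    have "\<not> anticomplete F (X i) (Y j) \<longleftrightarrow> F \<inter> B (i, j) \<noteq> {}" if "i < m" "j < m" for i j
      using dXY[OF that] by (fastforce simp: anticomplete_def B_def pairs_between_def)
    then show ?thesis by auto
  qed
  have "(\<Sum>F | F \<subseteq> ?\<Omega> \<and> (\<forall>i<m. \<forall>j<m. \<not> anticomplete F (X i) (Y j)). bernoulli_weight p ?\<Omega> F) =
        (\<Prod>a\<in>?I. 1 - (1 - p) ^ card (B a))"
    unfolding eq
  proof (rule sum_bernoulli_weight_hitting)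
    show "B a \<subseteq> ?\<Omega>" if "a \<in> ?I" for a
      using that sub by (fastforce simp: B_def pairs_between_def)
  qed (use V disj in \<open>auto intro: finite_pairs_between\<close>)
  also have "\<dots> \<le> (\<Prod>a\<in>?I. exp (- K / real m))"
  proof (rule prod_mono, safe)
    fix i j assume ij: "i < m" "j < m"
    have card: "card (B (i, j)) = card (X i) * card (Y j)"
      using card_pairs_between_disjoint[OF dXY[OF ij]] by (simp add: B_def)
    have "K / real m \<le> (1 - p) ^ card (B (i, j))"
      using K[OF ij] m by (simp add: card field_simps)
    then show "1 - (1 - p) ^ card (B (i, j)) \<le> exp (- K / real m)"
      using exp_ge_add_one_self[of "- K / real m"] by simp
    show "0 \<le> 1 - (1 - p) ^ card (B (i, j))"
      using p by (simp add: power_le_one)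
  qed
  also have "\<dots> = exp (- K / real m) ^ (m * m)"
    by (simp add: card_cartesian_product)
  also have "\<dots> = exp (- K * real m)"
    using m by (simp add: exp_of_nat_mult[symmetric])
  finally show ?thesis .
qed

text \<open>Let \<open>N\<close> be \<open>card V\<close>. For given \<open>m\<close> there are at
  most \<open>(N + 1) ^ (2 * s * m)\<close> systems, and the bound on \<open>K\<close> makes each
  fail with weight at most \<open>1 / (N + 1) ^ ((2 * s + 2) * m)\<close>. Summed over
  \<open>m \<le> N\<close>, the bad graphs have weight below \<open>1 / (N + 1)\<close>. The mean
  edge count is \<open>p\<close> times the number of pairs, of which bad graphs supply less than a
  \<open>1 / (N + 1)\<close> share, so some good graph has enough edges.\<close>

lemma exists_spreads_nonedges:
  assumes p: "0 < p" "p < 1" and V: "finite V" "V \<noteq> {}"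
    and K: "(2 * real s + 2) * ln (real (card V) + 1) \<le> K"
  shows "\<exists>E \<subseteq> pairs_between V V. spreads_nonedges V s (1 - p) K E \<and>
           (p - 1 / (real (card V) + 1)) * real (card V choose 2) \<le> real (card E)"
proof -
  let ?\<Omega> = "pairs_between V V" and ?w = "bernoulli_weight p (pairs_between V V)" and ?N = "card V"
  let ?M = "real ?N + 1" and ?c = "(p - 1 / (real ?N + 1)) * real (?N choose 2)"
  have N: "0 < ?N" using V by (simp add: card_gt_0_iff)
  have fin: "finite ?\<Omega>" using V by (simp add: finite_pairs_between)
  have w: "0 \<le> ?w F" for F using p by (simp add: bernoulli_weight_nonneg)
  have finS: "finite (small_sets V s)"
    by (rule finite_subset[of _ "Pow V"]) (use V in \<open>auto simp: small_sets_def\<close>)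
  have cardS: "card (small_sets V s) \<le> (?N + 1) ^ s"
    by (rule order.trans[OF card_mono card_small_subsets_le[OF V(1)]])
       (use V in \<open>auto simp: small_sets_def\<close>)
  define Sys where "Sys m = {(X, Y) \<in> (\<Pi>\<^sub>E i\<in>{..<m}. small_sets V s) \<times> (\<Pi>\<^sub>E i\<in>{..<m}. small_sets V s).
     disjoint_systems V s m X Y \<and> (\<forall>i<m. \<forall>j<m. K \<le> real m * (1 - p) ^ (card (X i) * card (Y j)))}" for m
  define Bad where "Bad m = (\<lambda>(X, Y). {F. F \<subseteq> ?\<Omega> \<and> (\<forall>i<m. \<forall>j<m. \<not> anticomplete F (X i) (Y j))})"
    for m :: nat
  define Bads where "Bads = (\<Union>m\<in>{1..?N}. \<Union>a\<in>Sys m. Bad m a)"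
  have finSys: "finite (Sys m)" for m
    unfolding Sys_def by (rule finite_subset[of _ "(\<Pi>\<^sub>E i\<in>{..<m}. small_sets V s) \<times> (\<Pi>\<^sub>E i\<in>{..<m}. small_sets V s)"])
      (use finS in \<open>auto intro!: finite_PiE\<close>)
  have cardSys: "real (card (Sys m)) \<le> ?M ^ (2 * s * m)" for m
  proof -
    have "card (Sys m) \<le> card ((\<Pi>\<^sub>E i\<in>{..<m}. small_sets V s) \<times> (\<Pi>\<^sub>E i\<in>{..<m}. small_sets V s))"
      unfolding Sys_def by (rule card_mono) (use finS in \<open>auto intro!: finite_PiE\<close>)
    also have "\<dots> = card (small_sets V s) ^ (2 * m)"
      by (simp add: card_cartesian_product card_PiE power_add mult_2)
    also have "\<dots> \<le> ((?N + 1) ^ s) ^ (2 * m)"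
      by (rule power_mono[OF cardS]) simp
    also have "\<dots> = (?N + 1) ^ (2 * s * m)"
      by (simp add: power_mult[symmetric] ac_simps)
    finally have "real (card (Sys m)) \<le> real ((?N + 1) ^ (2 * s * m))"
      by (simp only: of_nat_le_iff)
    then show ?thesis by (simp add: add.commute)
  qed
  have finBad: "finite (Bad m a)" for m a
    by (rule finite_subset[of _ "Pow ?\<Omega>"]) (use fin in \<open>auto simp: Bad_def\<close>)
  have wBad: "sum ?w (Bad m a) \<le> exp (- K * real m)" if "a \<in> Sys m" "m \<in> {1..?N}" for m a
    using that weight_no_anticomplete_pair_le[OF p V(1), of m s "fst a" "snd a" K]
    by (auto simp: Sys_def Bad_def case_prod_unfold)
  have "sum ?w Bads \<le> (\<Sum>m\<in>{1..?N}. sum ?w (\<Union>a\<in>Sys m. Bad m a))"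
    unfolding Bads_def by (rule sum_UN_le) (use finSys finBad w in auto)
  also have "\<dots> \<le> (\<Sum>m\<in>{1..?N}. 1 / ?M ^ 2)"
  proof (rule sum_mono)
    fix m assume m: "m \<in> {1..?N}"
    have "sum ?w (\<Union>a\<in>Sys m. Bad m a) \<le> (\<Sum>a\<in>Sys m. sum ?w (Bad m a))"
      by (rule sum_UN_le) (use finSys finBad w in auto)
    also have "\<dots> \<le> (\<Sum>a\<in>Sys m. exp (- K * real m))"
      by (rule sum_mono) (use wBad m in auto)
    also have "\<dots> \<le> ?M ^ (2 * s * m) * exp (- K * real m)"
      using cardSys[of m] by (simp add: mult_right_mono)
    also have "\<dots> \<le> ?M ^ (2 * s * m) * exp (- ((2 * real s + 2) * ln ?M) * real m)"
      using K by (intro mult_left_mono) (auto intro!: mult_right_mono)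
    also have "exp (- ((2 * real s + 2) * ln ?M) * real m) = 1 / ?M ^ ((2 * s + 2) * m)"
    proof -
      have "exp (real ((2 * s + 2) * m) * ln ?M) = ?M ^ ((2 * s + 2) * m)"
        by (subst exp_of_nat_mult) simp
      moreover have "- ((2 * real s + 2) * ln ?M) * real m = - (real ((2 * s + 2) * m) * ln ?M)"
        by (simp add: algebra_simps)
      ultimately show ?thesis by (simp only: exp_minus inverse_eq_divide)
    qed
    also have "?M ^ (2 * s * m) * (1 / ?M ^ ((2 * s + 2) * m)) = 1 / ?M ^ (2 * m)"
      by (simp add: add_mult_distrib power_add)
    also have "\<dots> \<le> 1 / ?M ^ 2"
      using m by (intro divide_left_mono power_increasing) auto
    finally show "sum ?w (\<Union>a\<in>Sys m. Bad m a) \<le> 1 / ?M ^ 2" .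
  qed
  also have "\<dots> = real ?N / ?M ^ 2" by simp
  also have "\<dots> < 1 / ?M"
    by (simp add: power2_eq_square divide_simps)
  finally have b: "sum ?w Bads < 1 / ?M" .
  have BadsSub: "Bads \<subseteq> Pow ?\<Omega>" by (auto simp: Bads_def Bad_def)
  have tot: "sum ?w Bads + sum ?w (Pow ?\<Omega> - Bads) = 1"
    using sum_bernoulli_weight[OF fin, of p] sum.subset_diff[OF BadsSub, of ?w] fin by simp
  have good: "spreads_nonedges V s (1 - p) K F" if F: "F \<in> Pow ?\<Omega> - Bads" for F
    unfolding spreads_nonedges_def
  proof (intro allI impI, rule ccontr)
    fix m :: nat and X Y
    assume m: "0 < m" and XY: "disjoint_systems V s m X Y"
      and KXY: "\<forall>i<m. \<forall>j<m. K \<le> real m * (1 - p) ^ (card (X i) * card (Y j))"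
      and neg: "\<not> (\<exists>i<m. \<exists>j<m. anticomplete F (X i) (Y j))"
    have X: "X i \<subseteq> V" "X i \<noteq> {}" if "i < m" for i
      using XY that by (auto simp: disjoint_systems_def small_sets_def)
    \<comment> \<open>The sets \<open>X i\<close> are disjoint non-empty subsets of
      \<open>V\<close>, so the union over \<open>m\<close> up to \<open>card V\<close> covers every
      system.\<close>
    have "m \<le> ?N"
    proof -
      have "m = (\<Sum>i<m. 1)" by simp
      also have "\<dots> \<le> (\<Sum>i<m. card (X i))"
        using X V(1) by (intro sum_mono) (auto simp: Suc_le_eq card_gt_0_iff intro: finite_subset)
      also have "\<dots> = card (\<Union>i<m. X i)"
        by (rule card_UN_disjoint'[symmetric])
           (use XY X V(1) in \<open>auto simp: disjoint_systems_def intro: finite_subset\<close>)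
      also have "\<dots> \<le> ?N" using X V(1) by (intro card_mono) auto
      finally show ?thesis .
    qed
    \<comment> \<open>Restriction makes the families extensional, as membership in the finite set
      \<open>Sys m\<close> demands.\<close>
    let ?X = "restrict X {..<m}" and ?Y = "restrict Y {..<m}"
    have "disjoint_systems V s m ?X ?Y"
      using XY by (auto simp: disjoint_systems_def disjoint_family_on_def)
    then have "(?X, ?Y) \<in> Sys m"
      using KXY by (auto simp: Sys_def disjoint_systems_def)
    moreover have "F \<in> Bad m (?X, ?Y)"
      using neg F by (auto simp: Bad_def)
    ultimately have "F \<in> Bads" unfolding Bads_def using m \<open>m \<le> ?N\<close> by auto
    then show False using F by simp
  qed
  have "\<exists>F \<in> Pow ?\<Omega> - Bads. ?c \<le> real (card F)"
  proof (rule ccontr)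
    assume neg: "\<not> ?thesis"
    have less: "real (card F) < ?c" if "F \<in> Pow ?\<Omega> - Bads" for F
      using neg that by (meson not_le)
    \<comment> \<open>Good graphs have positive total weight, so one exists, and by the assumption
      to be refuted it has fewer than \<open>?c\<close> edges. Hence \<open>?c\<close> is positive,
      which allows the weight of the good graphs to be replaced by 1 below.\<close>
    obtain F where "F \<in> Pow ?\<Omega> - Bads"
    proof (rule ccontr)
      assume "\<not> thesis"
      then have "Pow ?\<Omega> - Bads = {}" using that by blast
      then have "sum ?w (Pow ?\<Omega> - Bads) = 0" by (simp only: sum.empty)
      then have "1 < 1 / ?M" using tot b by linarith
      then show False using N by simp
    qed
    then have c: "0 < ?c" using less[of F] by (meson le_less_trans of_nat_0_le_iff)
    then have \<Omega>: "0 < real (?N choose 2)" by (metis mult_zero_right of_nat_0_le_iff order_less_le)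
    have "p * real (?N choose 2) = (\<Sum>F\<in>Pow ?\<Omega>. ?w F * real (card F))"
      using sum_bernoulli_weight_card[OF fin, of p] card_pairs_between_same[OF V(1)] by simp
    also have "\<dots> = (\<Sum>F\<in>Pow ?\<Omega> - Bads. ?w F * real (card F)) + (\<Sum>F\<in>Bads. ?w F * real (card F))"
      using BadsSub fin by (intro sum.subset_diff) auto
    also have "(\<Sum>F\<in>Pow ?\<Omega> - Bads. ?w F * real (card F)) \<le> (\<Sum>F\<in>Pow ?\<Omega> - Bads. ?w F * ?c)"
      using less w by (intro sum_mono mult_left_mono) (auto intro: less_imp_le)
    also have "(\<Sum>F\<in>Pow ?\<Omega> - Bads. ?w F * ?c) = sum ?w (Pow ?\<Omega> - Bads) * ?c"
      by (rule sum_distrib_right[symmetric])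
    also have "\<dots> \<le> 1 * ?c"
      using tot c sum_nonneg[of Bads ?w] w by (intro mult_right_mono) auto
    also have "(\<Sum>F\<in>Bads. ?w F * real (card F)) \<le> (\<Sum>F\<in>Bads. ?w F * real (?N choose 2))"
      using w BadsSub fin card_pairs_between_same[OF V(1)]
      by (intro sum_mono mult_left_mono) (auto intro!: card_mono simp flip: card_pairs_between_same[OF V(1)])
    also have "\<dots> = sum ?w Bads * real (?N choose 2)"
      by (rule sum_distrib_right[symmetric])
    also have "\<dots> < 1 / ?M * real (?N choose 2)"
      using b \<Omega> by (rule mult_strict_right_mono)
    finally show False by (simp add: algebra_simps)
  qed
  then show ?thesis using good by blast
qed

section \<open>Non-adjacent pairs in families of small sets\<close>

text \<open>Greedy choice: each element of \<open>W\<close> or of a set already chosen rules out at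
  most \<open>k\<close> indices, so some index remains until \<open>m\<close> sets have been
  found.\<close>

lemma exists_disjoint_selection:
  assumes U: "finite U" "\<And>u. u \<in> U \<Longrightarrow> finite (X u) \<and> card (X u) \<le> s"
    and k: "\<And>v. card {u \<in> U. v \<in> X u} \<le> k"
    and W: "finite W" and big: "k * (card W + m * s) < card U"
  shows "\<exists>f. (\<forall>i<m. f i \<in> U \<and> X (f i) \<inter> W = {}) \<and> disjoint_family_on (\<lambda>i. X (f i)) {..<m}"
  using big
proof (induction m)
  case 0
  then show ?case by (simp add: disjoint_family_on_def)
next
  case (Suc m)
  have "k * (card W + m * s) \<le> k * (card W + Suc m * s)" by simp
  from Suc.IH[OF le_less_trans[OF this Suc.prems]]
  obtain f where f: "\<forall>i<m. f i \<in> U \<and> X (f i) \<inter> W = {}"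
      and disj: "disjoint_family_on (\<lambda>i. X (f i)) {..<m}"
    by blast
  let ?W = "W \<union> (\<Union>i<m. X (f i))"
  have finW: "finite ?W" using W U(2) f by auto
  have "card (\<Union>i<m. X (f i)) \<le> (\<Sum>i<m. card (X (f i)))" by (rule card_UN_le) simp
  also have "\<dots> \<le> (\<Sum>i<m. s)" by (rule sum_mono) (use U(2) f in auto)
  finally have "card ?W \<le> card W + m * s"
    using card_Un_le[of W "\<Union>i<m. X (f i)"] by simp
  have "card {u \<in> U. X u \<inter> ?W \<noteq> {}} \<le> card (\<Union>v\<in>?W. {u \<in> U. v \<in> X u})"
    by (rule card_mono) (use finW U in auto)
  also have "\<dots> \<le> (\<Sum>v\<in>?W. card {u \<in> U. v \<in> X u})" by (rule card_UN_le) (rule finW)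
  also have "\<dots> \<le> (\<Sum>v\<in>?W. k)" by (rule sum_mono) (rule k)
  also have "\<dots> = k * card ?W" by simp
  also have "\<dots> \<le> k * (card W + Suc m * s)"
    using \<open>card ?W \<le> card W + m * s\<close> by (intro mult_left_mono) auto
  finally have "card {u \<in> U. X u \<inter> ?W \<noteq> {}} < card U" using Suc.prems by simp
  then have "{u \<in> U. X u \<inter> ?W \<noteq> {}} \<noteq> U" by force
  then obtain u where u: "u \<in> U" "X u \<inter> ?W = {}" by blast
  let ?f = "f(m := u)"
  have "\<forall>i<Suc m. ?f i \<in> U \<and> X (?f i) \<inter> W = {}" using f u by (auto simp: less_Suc_eq)
  moreover have "disjoint_family_on (\<lambda>i. X (?f i)) {..<Suc m}"
    unfolding disjoint_family_on_def
  proof (intro ballI impI)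
    fix i j assume ij: "i \<in> {..<Suc m}" "j \<in> {..<Suc m}" "i \<noteq> j"
    consider "i = m" "j < m" | "j = m" "i < m" | "i < m" "j < m"
      using ij by (auto simp: less_Suc_eq)
    then show "X (?f i) \<inter> X (?f j) = {}"
    proof cases
      case 3
      then show ?thesis using disjoint_family_onD[OF disj, of i j] ij by simp
    qed (use u(2) in auto)
  qed
  ultimately show ?case by blast
qed

text \<open>Call \<open>u\<close> in \<open>U\<close> poor (the set \<open>?L\<close>) if it has
  fewer than \<open>card U' / (2 * m)\<close> partners. From more than \<open>k * m * s\<close> poor
  indices one can choose \<open>m\<close> with disjoint sets, and at least half of \<open>U'\<close>
  is a partner of none of these. From that half \<open>m\<close> more sets are chosen, disjoint from
  each other and from the first ones; \<open>E\<close> then yields an anticomplete pair, a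
  contradiction. So at least half of \<open>U\<close> is not poor, and summing partners gives the
  claim. \<open>U\<close> and \<open>U'\<close> may overlap, as happens when both come from one
  part.\<close>

lemma many_anticomplete_pairs:
  assumes E: "spreads_nonedges V s q K E" and V: "finite V" and m: "0 < m"
    and fin: "finite U" "finite U'"
    and X: "\<And>u. u \<in> U \<union> U' \<Longrightarrow> X u \<in> small_sets V s"
    and k: "\<And>v. card {u \<in> U \<union> U'. v \<in> X u} \<le> k"
    and K: "\<And>u v. u \<in> U \<Longrightarrow> v \<in> U' \<Longrightarrow> K \<le> real m * q ^ (card (X u) * card (X v))"
    and U: "2 * k * m * s \<le> card U" and U': "4 * k * m * s < card U'"
  shows "card U * card U' \<le> 4 * m * card {(u, v) \<in> U \<times> U'. u \<noteq> v \<and> anticomplete E (X u) (X v)}"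
proof -
  define N where "N u = {v \<in> U'. u \<noteq> v \<and> anticomplete E (X u) (X v)}" for u
  have finN: "finite (N u)" for u using fin by (simp add: N_def)
  let ?L = "{u \<in> U. 2 * m * card (N u) < card U'}"
  have kU: "card {u \<in> Z. v \<in> X u} \<le> k" if "Z \<subseteq> U \<union> U'" for Z v
    by (rule order.trans[OF card_mono k[of v]]) (use fin that in auto)
  have X': "finite (X u) \<and> card (X u) \<le> s" if "u \<in> U \<union> U'" for u
    using X[OF that] V by (auto simp: small_sets_def intro: finite_subset)
  have L: "card ?L \<le> k * (m * s)"
  proof (rule ccontr)
    assume "\<not> ?thesis"
    then have big: "k * (card ({} :: 'a set) + m * s) < card ?L" by simp
    have kL: "card {u \<in> ?L. v \<in> X u} \<le> k" for v by (rule kU) auto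
    obtain f where f: "\<forall>i<m. f i \<in> ?L" and df: "disjoint_family_on (\<lambda>i. X (f i)) {..<m}"
      using exists_disjoint_selection[of ?L X s k "{}" m, OF _ _ kL _ big] fin X' by auto
    let ?R = "U' - (\<Union>i<m. N (f i))" and ?W = "\<Union>i<m. X (f i)"
    have "m * (2 * card (\<Union>i<m. N (f i))) \<le> m * (2 * (\<Sum>i<m. card (N (f i))))"
      by (intro mult_left_mono card_UN_le) auto
    also have "\<dots> = (\<Sum>i<m. 2 * m * card (N (f i)))" by (simp add: sum_distrib_left mult_ac)
    also have "\<dots> \<le> (\<Sum>i<m. card U')"
      by (rule sum_mono) (use f in \<open>auto intro: less_imp_le\<close>)
    finally have "2 * card (\<Union>i<m. N (f i)) \<le> card U'" using m by simp
    moreover have "card ?R = card U' - card (\<Union>i<m. N (f i))"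
      by (rule card_Diff_subset) (use finN in \<open>auto simp: N_def\<close>)
    ultimately have R: "2 * k * m * s < card ?R" using U' by simp
    have "card ?W \<le> (\<Sum>i<m. card (X (f i)))" by (rule card_UN_le) simp
    also have "\<dots> \<le> (\<Sum>i<m. s)" by (rule sum_mono) (use X' f in auto)
    finally have "card ?W \<le> m * s" by simp
    then have "k * (card ?W + m * s) \<le> k * (m * s + m * s)" by (intro mult_left_mono) auto
    also have "\<dots> = 2 * k * m * s" by (simp add: algebra_simps)
    finally have big': "k * (card ?W + m * s) < card ?R" using R by (rule le_less_trans)
    have finW: "finite ?W" using X' f by auto
    have kR: "card {u \<in> ?R. v \<in> X u} \<le> k" for v by (rule kU) auto
    obtain g where g: "\<forall>i<m. g i \<in> ?R \<and> X (g i) \<inter> ?W = {}"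
        and dg: "disjoint_family_on (\<lambda>i. X (g i)) {..<m}"
      using exists_disjoint_selection[of ?R X s k ?W m, OF _ _ kR finW big'] fin X' by auto
    have dis: "X (f i) \<inter> X (g j) = {}" if "i < m" "j < m" for i j
      using g that by blast
    have "disjoint_systems V s m (\<lambda>i. X (f i)) (\<lambda>i. X (g i))"
      unfolding disjoint_systems_def using f g X df dg dis by auto
    moreover have "\<forall>i<m. \<forall>j<m. K \<le> real m * q ^ (card (X (f i)) * card (X (g j)))"
      using f g K by auto
    ultimately obtain i j where ij: "i < m" "j < m" "anticomplete E (X (f i)) (X (g j))"
      using E m unfolding spreads_nonedges_def by blast
    \<comment> \<open>Disjointness separates the indices only because the sets are non-empty, and
      \<open>N\<close> admits only partners different from \<open>u\<close>.\<close>
    have "X (g j) \<noteq> {}" using X[of "g j"] g ij(2) by (auto simp: small_sets_def)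
    then have "f i \<noteq> g j" using dis[OF ij(1,2)] by auto
    then have "g j \<in> N (f i)" using ij g by (auto simp: N_def)
    then show False using g ij by blast
  qed
  have "{(u, v) \<in> U \<times> U'. u \<noteq> v \<and> anticomplete E (X u) (X v)} = Sigma U N"
    by (auto simp: N_def)
  then have "card {(u, v) \<in> U \<times> U'. u \<noteq> v \<and> anticomplete E (X u) (X v)} = (\<Sum>u\<in>U. card (N u))"
    using fin finN by (simp add: card_SigmaI)
  then have sum: "2 * m * card {(u, v) \<in> U \<times> U'. u \<noteq> v \<and> anticomplete E (X u) (X v)} =
        (\<Sum>u\<in>U. 2 * m * card (N u))" by (simp add: sum_distrib_left)
  have "(card U - card ?L) * card U' = (\<Sum>u\<in>U - ?L. card U')"
    using fin by (simp add: card_Diff_subset)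
  also have "\<dots> \<le> (\<Sum>u\<in>U - ?L. 2 * m * card (N u))"
    by (rule sum_mono) auto
  also have "\<dots> \<le> (\<Sum>u\<in>U. 2 * m * card (N u))"
    by (rule sum_mono2) (use fin in auto)
  finally have "2 * ((card U - card ?L) * card U') \<le>
      4 * m * card {(u, v) \<in> U \<times> U'. u \<noteq> v \<and> anticomplete E (X u) (X v)}"
    unfolding sum[symmetric] by linarith
  moreover have "card U \<le> 2 * (card U - card ?L)" using L U by simp
  then have "card U * card U' \<le> 2 * ((card U - card ?L) * card U')"
    by (metis mult.assoc mult_le_mono1)
  ultimately show ?thesis by (meson order.trans)
qed

section \<open>Blow-ups and their minors\<close>

text \<open>The base vertex of \<open>x\<close> is \<open>x mod N\<close>, so every residue class
  consists of \<open>k\<close> copies of one base vertex. Natural numbers serve as vertices because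
  \<open>minor_threshold\<close> ranges over hosts on \<open>nat\<close>.\<close>

definition blowup :: "nat \<Rightarrow> nat \<Rightarrow> nat set set \<Rightarrow> nat graph" where
  "blowup N k E = ({..<N * k}, {{x, y} | x y. x < N * k \<and> y < N * k \<and> {x mod N, y mod N} \<in> E})"

lemma card_fibre_mod:
  fixes N :: nat
  assumes "u < N"
  shows "card {x. x < N * k \<and> x mod N = u} = k"
proof -
  have "{x. x < N * k \<and> x mod N = u} = (\<lambda>a. u + a * N) ` {..<k}"
  proof (intro equalityI subsetI)
    fix x assume x: "x \<in> {x. x < N * k \<and> x mod N = u}"
    then have "x div N < k" by (simp add: less_mult_imp_div_less mult.commute)
    moreover have "x = u + x div N * N" using x by (metis (lifting) mem_Collect_eq mod_div_mult_eq)
    ultimately show "x \<in> (\<lambda>a. u + a * N) ` {..<k}" by blast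
  next
    fix x assume "x \<in> (\<lambda>a. u + a * N) ` {..<k}"
    then obtain a where a: "a < k" "x = u + a * N" by auto
    have "x < (a + 1) * N" using a assms by simp
    also have "\<dots> \<le> k * N" using a by (intro mult_right_mono) auto
    finally show "x \<in> {x. x < N * k \<and> x mod N = u}" using a assms by (simp add: mult.commute)
  qed
  moreover have "inj_on (\<lambda>a. u + a * N) {..<k}" using assms by (auto simp: inj_on_def)
  ultimately show ?thesis by (simp add: card_image)
qed

lemma simple_graph_blowup:
  assumes "E \<subseteq> pairs_between {..<N} {..<N}"
  shows "simple_graph (blowup N k E)"
proof -
  have "x \<noteq> y" if "{x mod N, y mod N} \<in> E" for x y
    using that assms by (fastforce simp: pairs_between_def doubleton_eq_iff)
  then show ?thesis unfolding simple_graph_def blowup_def by fastforce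
qed

text \<open>A base edge lifts to the \<open>k * k\<close> pairs between two fibres. Projecting back
  recovers the base edge, so distinct base edges have disjoint lifts.\<close>

lemma card_edges_blowup:
  assumes E: "E \<subseteq> pairs_between {..<N} {..<N}"
  shows "card (edges (blowup N k E)) = k ^ 2 * card E"
proof -
  define F where "F e = {{x, y} | x y. x < N * k \<and> y < N * k \<and> {x mod N, y mod N} = e}" for e
  have cF: "finite (F e) \<and> card (F e) = k ^ 2" if "e \<in> E" for e
  proof -
    obtain u v where uv: "e = {u, v}" "u < N" "v < N" "u \<noteq> v"
    proof -
      have "e \<in> pairs_between {..<N} {..<N}" using \<open>e \<in> E\<close> E by blast
      then show thesis using that unfolding pairs_between_def by blast
    qed
    let ?S = "\<lambda>u. {x. x < N * k \<and> x mod N = u}"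
    have "F e = pairs_between (?S u) (?S v)"
    proof (intro equalityI subsetI)
      fix f assume "f \<in> F e"
      then obtain x y where xy: "f = {x, y}" "x < N * k" "y < N * k" "{x mod N, y mod N} = {u, v}"
        unfolding F_def uv(1) by blast
      from xy(4) consider "x mod N = u" "y mod N = v" | "x mod N = v" "y mod N = u"
        by (auto simp: doubleton_eq_iff)
      then show "f \<in> pairs_between (?S u) (?S v)"
      proof cases
        case 1
        then show ?thesis using xy uv(4) unfolding pairs_between_def by blast
      next
        case 2
        moreover have "f = {y, x}" using xy(1) by blast
        ultimately show ?thesis using xy uv(4) unfolding pairs_between_def by blast
      qed
    next
      fix f assume "f \<in> pairs_between (?S u) (?S v)"
      then show "f \<in> F e" unfolding F_def uv(1) pairs_between_def by blast
    qed
    moreover have "card (pairs_between (?S u) (?S v)) = card (?S u) * card (?S v)"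
      by (rule card_pairs_between_disjoint) (use uv in auto)
    moreover have "finite (pairs_between (?S u) (?S v))"
      by (rule finite_pairs_between) auto
    ultimately show ?thesis using card_fibre_mod uv by (simp add: power2_eq_square)
  qed
  have img: "(\<lambda>x. x mod N) ` f = e" if "f \<in> F e" for f e
    using that by (auto simp: F_def)
  have finE: "finite E"
    by (rule finite_subset[OF E]) (simp add: finite_pairs_between)
  have "edges (blowup N k E) = (\<Union>e\<in>E. F e)"
    unfolding blowup_def F_def by auto
  also have "card \<dots> = (\<Sum>e\<in>E. card (F e))"
    by (rule card_UN_disjoint[OF finE]) (use cF img in blast)+
  also have "\<dots> = k ^ 2 * card E" using cF by simp
  finally show ?thesis .
qed

text \<open>\<open>X u\<close> is the projection of the branch set of \<open>u\<close> to the base,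
  and \<open>b u\<close> is the size of that branch set. The sizes add up to at most
  \<open>N * k\<close> because branch sets are disjoint, and at most \<open>k\<close> projections
  share a base vertex because disjoint branch sets use different copies of it.\<close>

lemma minor_of_blowup:
  assumes minor: "is_minor H (blowup N k E)" and fin: "finite (verts H)" and N: "0 < N"
  obtains X b where "\<And>u. u \<in> verts H \<Longrightarrow> X u \<subseteq> {..<N} \<and> X u \<noteq> {} \<and> card (X u) \<le> b u"
    "(\<Sum>u\<in>verts H. b u) \<le> N * k"
    "\<And>v. card {u \<in> verts H. v \<in> X u} \<le> k"
    "\<And>u v. u \<in> verts H \<Longrightarrow> v \<in> verts H \<Longrightarrow> {u, v} \<in> edges H \<Longrightarrow> \<not> anticomplete E (X u) (X v)"
proof -
  have vb: "verts (blowup N k E) = {..<N * k}" by (simp add: blowup_def)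
  obtain B where B0: "(\<forall>u\<in>verts H. B u \<noteq> {} \<and> B u \<subseteq> {..<N * k} \<and> induces_connected (blowup N k E) (B u)) \<and>
      (\<forall>u\<in>verts H. \<forall>v\<in>verts H. u \<noteq> v \<longrightarrow> B u \<inter> B v = {}) \<and>
      (\<forall>u\<in>verts H. \<forall>v\<in>verts H. {u, v} \<in> edges H \<longrightarrow>
         (\<exists>x\<in>B u. \<exists>y\<in>B v. {x, y} \<in> edges (blowup N k E)))"
    using minor unfolding is_minor_def vb by (rule exE)
  have B: "B u \<noteq> {} \<and> B u \<subseteq> {..<N * k}" if "u \<in> verts H" for u
    using bspec[OF conjunct1[OF B0] that] by simp
  have disj: "B u \<inter> B v = {}" if "u \<in> verts H" "v \<in> verts H" "u \<noteq> v" for u v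
    using bspec[OF bspec[OF conjunct1[OF conjunct2[OF B0]] that(1)] that(2)] that(3) by simp
  have edge: "\<exists>x\<in>B u. \<exists>y\<in>B v. {x, y} \<in> edges (blowup N k E)"
    if "u \<in> verts H" "v \<in> verts H" "{u, v} \<in> edges H" for u v
    using bspec[OF bspec[OF conjunct2[OF conjunct2[OF B0]] that(1)] that(2)] that(3) by simp
  have finB: "finite (B u)" if "u \<in> verts H" for u
    using B[OF that] by (auto intro: finite_subset)
  define X where "X u = (\<lambda>x. x mod N) ` B u" for u
  show ?thesis
  proof
    show "X u \<subseteq> {..<N} \<and> X u \<noteq> {} \<and> card (X u) \<le> card (B u)" if "u \<in> verts H" for u
      using B[OF that] N finB[OF that] by (auto simp: X_def intro: card_image_le)
    have "(\<Sum>u\<in>verts H. card (B u)) = card (\<Union>u\<in>verts H. B u)"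
      using card_UN_disjoint[OF fin, of B] disj finB by simp
    also have "\<dots> \<le> card {..<N * k}" by (rule card_mono) (use B in auto)
    finally show "(\<Sum>u\<in>verts H. card (B u)) \<le> N * k" by simp
    show "\<not> anticomplete E (X u) (X v)" if uv: "u \<in> verts H" "v \<in> verts H" "{u, v} \<in> edges H" for u v
    proof -
      obtain x y where xy: "x \<in> B u" "y \<in> B v" "{x, y} \<in> edges (blowup N k E)"
        using edge[OF uv] by blast
      then have "\<exists>x' y'. {x, y} = {x', y'} \<and> {x' mod N, y' mod N} \<in> E"
        unfolding blowup_def by auto
      then obtain x' y' where "{x, y} = {x', y'}" "{x' mod N, y' mod N} \<in> E"
        by blast
      then have "{x mod N, y mod N} \<in> E" by (metis doubleton_eq_iff)
      then show ?thesis using xy by (auto simp: anticomplete_def X_def)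
    qed
    show "card {u \<in> verts H. v \<in> X u} \<le> k" for v
    proof (cases "v < N")
      case True
      let ?U = "{u \<in> verts H. v \<in> X u}" and ?S = "{x. x < N * k \<and> x mod N = v}"
      have "card ?U = (\<Sum>u\<in>?U. 1)" by simp
      also have "\<dots> \<le> (\<Sum>u\<in>?U. card (B u \<inter> ?S))"
      proof (rule sum_mono)
        fix u assume u: "u \<in> ?U"
        then obtain x where "x \<in> B u" "x mod N = v" by (auto simp: X_def)
        then have "x \<in> B u \<inter> ?S" using B u by auto
        then have "0 < card (B u \<inter> ?S)" by (auto simp: card_gt_0_iff)
        then show "1 \<le> card (B u \<inter> ?S)" by simp
      qed
      also have "\<dots> = card (\<Union>u\<in>?U. B u \<inter> ?S)"
      proof (rule card_UN_disjoint[symmetric])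
        show "\<forall>u\<in>?U. \<forall>w\<in>?U. u \<noteq> w \<longrightarrow> (B u \<inter> ?S) \<inter> (B w \<inter> ?S) = {}"
        proof (intro ballI impI)
          fix u w assume "u \<in> ?U" "w \<in> ?U" "u \<noteq> w"
          then have "B u \<inter> B w = {}" using disj by simp
          then show "(B u \<inter> ?S) \<inter> (B w \<inter> ?S) = {}" by blast
        qed
      qed (use fin in auto)
      also have "\<dots> \<le> card ?S" by (rule card_mono) auto
      finally show ?thesis using card_fibre_mod[OF True] by simp
    next
      case False
      then have "{u \<in> verts H. v \<in> X u} = {}" using N by (auto simp: X_def)
      then show ?thesis by (simp only: card.empty)
    qed
  qed
qed

lemma minor_threshold_ge:
  fixes G :: "nat graph"
  assumes "simple_graph G" "verts G \<noteq> {}" "\<not> is_minor H G"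
    and "c \<le> real (card (edges G)) / real (card (verts G))"
  shows "ereal c \<le> minor_threshold H"
  unfolding minor_threshold_def
proof (rule Inf_greatest, clarify)
  fix c' assume "\<forall>G :: nat graph. simple_graph G \<and> verts G \<noteq> {} \<and>
    c' \<le> real (card (edges G)) / real (card (verts G)) \<longrightarrow> is_minor H G"
  then have "\<not> c' \<le> real (card (edges G)) / real (card (verts G))" using assms(1-3) by blast
  then show "ereal c \<le> ereal c'" using assms(4) by simp
qed

section \<open>The class of graphs with prescribed edge counts\<close>

text \<open>For \<open>M \<le> a\<close>, the probability that \<open>M\<close> random elements out
  of \<open>a\<close> avoid \<open>z\<close> given ones is the product of the factors
  \<open>(a - z - i) / (a - i)\<close> over \<open>i < M\<close>, each at most
  \<open>1 - z / a\<close>. The induction adds one factor at a time.\<close>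

lemma binomial_diff_le:
  assumes "z \<le> a"
  shows "real ((a - z) choose M) \<le> exp (- (real z / real a * real M)) * real (a choose M)"
proof -
  have "real ((a - z) choose M) \<le> (1 - real z / real a) ^ M * real (a choose M)"
  proof (induction M)
    case (Suc M)
    show ?case
    proof (cases "M < a - z")
      case False
      then have "(a - z) choose Suc M = 0" by (simp add: binomial_eq_0)
      moreover have "0 \<le> 1 - real z / real a" using assms by (cases "a = 0") (auto simp: divide_le_eq_1)
      ultimately show ?thesis by (simp only: of_nat_0) simp
    next
      case True
      have rec: "real (Suc M) * real (n choose Suc M) = real (n - M) * real (n choose M)" for n
        unfolding of_nat_mult[symmetric] binomial_absorption binomial_absorb_comp ..
      have le: "real (a - z - M) \<le> (1 - real z / real a) * real (a - M)"
        using True assms by (simp add: field_simps of_nat_diff)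
      have "real (Suc M) * real ((a - z) choose Suc M) = real (a - z - M) * real ((a - z) choose M)"
        by (rule rec)
      also have "\<dots> \<le> ((1 - real z / real a) * real (a - M)) * ((1 - real z / real a) ^ M * real (a choose M))"
        by (intro mult_mono le Suc.IH) (use True assms in \<open>auto simp: divide_le_eq_1 intro!: mult_nonneg_nonneg\<close>)
      also have "\<dots> = (1 - real z / real a) ^ Suc M * (real (a - M) * real (a choose M))"
        by simp
      also have "\<dots> = real (Suc M) * ((1 - real z / real a) ^ Suc M * real (a choose Suc M))"
        unfolding rec[symmetric] by simp
      finally show ?thesis by (simp del: of_nat_Suc power_Suc binomial_Suc_Suc)
    qed
  qed simp
  also have "(1 - real z / real a) ^ M \<le> exp (- (real z / real a)) ^ M"
    using exp_ge_add_one_self[of "- (real z / real a)"] assms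
    by (intro power_mono) (auto simp: divide_le_eq_1)
  also have "exp (- (real z / real a)) ^ M = exp (- (real z / real a * real M))"
    by (simp add: exp_of_nat_mult[symmetric] mult.commute)
  finally show ?thesis by (simp add: mult_right_mono)
qed

text \<open>Splitting \<open>E\<close> into \<open>E \<inter> A\<close> and \<open>E - A\<close>
  turns the family into a product. Taking \<open>A' = A\<close> counts a whole class and a smaller
  \<open>A'\<close> its members avoiding \<open>A - A'\<close>; the second factor is common to
  both.\<close>

lemma card_fixed_trace:
  assumes fin: "finite \<Omega>" and A: "A' \<subseteq> A" "A \<subseteq> \<Omega>"
  shows "card {E. E \<subseteq> \<Omega> \<and> E \<inter> A \<subseteq> A' \<and> card (E \<inter> A) = M \<and> Q (E - A)} =
         (card A' choose M) * card {R. R \<subseteq> \<Omega> - A \<and> Q R}"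
proof -
  let ?S = "{S. S \<subseteq> A' \<and> card S = M}" and ?R = "{R. R \<subseteq> \<Omega> - A \<and> Q R}"
  have "{E. E \<subseteq> \<Omega> \<and> E \<inter> A \<subseteq> A' \<and> card (E \<inter> A) = M \<and> Q (E - A)} = (\<lambda>(S, R). S \<union> R) ` (?S \<times> ?R)"
  proof (intro equalityI subsetI)
    fix E assume E: "E \<in> {E. E \<subseteq> \<Omega> \<and> E \<inter> A \<subseteq> A' \<and> card (E \<inter> A) = M \<and> Q (E - A)}"
    then have "(E \<inter> A, E - A) \<in> ?S \<times> ?R" by auto
    moreover have "E = (\<lambda>(S, R). S \<union> R) (E \<inter> A, E - A)" by auto
    ultimately show "E \<in> (\<lambda>(S, R). S \<union> R) ` (?S \<times> ?R)" by (rule rev_image_eqI)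
  next
    fix E assume "E \<in> (\<lambda>(S, R). S \<union> R) ` (?S \<times> ?R)"
    then obtain S R where SR: "S \<subseteq> A'" "card S = M" "R \<subseteq> \<Omega> - A" "Q R" "E = S \<union> R" by auto
    have "E \<inter> A = S" "E - A = R" using SR A by auto
    then show "E \<in> {E. E \<subseteq> \<Omega> \<and> E \<inter> A \<subseteq> A' \<and> card (E \<inter> A) = M \<and> Q (E - A)}"
      using SR A by auto
  qed
  moreover have "inj_on (\<lambda>(S, R). S \<union> R) (?S \<times> ?R)"
  proof (rule inj_onI, clarify)
    fix S R S' R'
    assume "S \<subseteq> A'" "S' \<subseteq> A'" "R \<subseteq> \<Omega> - A" "R' \<subseteq> \<Omega> - A" "S \<union> R = S' \<union> R'"
    then show "S = S' \<and> R = R'" using A(1) by blast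
  qed
  moreover have "finite A'" using fin A by (auto intro: finite_subset)
  ultimately show ?thesis by (simp add: card_image card_cartesian_product n_subsets)
qed

section \<open>Sizes and positions of the parts\<close>

lemma part_size_sum:
  assumes "weight_vector r \<sigma>"
  shows "(\<Sum>i=1..r. part_size r \<sigma> t i) = t"
  using someI_ex[OF ex_rounding_index[OF assms, of t]] by (simp add: part_size_def)

text \<open>The bound holds for every rounding index, hence also for the one picked by
  \<open>SOME\<close>.\<close>

lemma part_size_ge: "\<sigma> i * real t - 1 \<le> real (part_size r \<sigma> t i)"
proof -
  have "\<sigma> i * real t - 1 \<le> real (rounded_size \<sigma> t j i)" for j
    unfolding rounded_size_def by (auto split: if_splits) linarith+
  then show ?thesis by (simp add: part_size_def)
qed

lemma card_part: "1 \<le> i \<Longrightarrow> card (part r \<sigma> t i) = part_size r \<sigma> t i"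
  using sum.atLeastLessThan_Suc[of 1 i "part_size r \<sigma> t"]
  by (simp add: part_def atLeastLessThanSuc_atLeastAtMost)

lemma part_subset:
  assumes "weight_vector r \<sigma>" "i \<in> {1..r}"
  shows "part r \<sigma> t i \<subseteq> {1..t}"
proof -
  have "(\<Sum>k=1..i. part_size r \<sigma> t k) \<le> (\<Sum>k=1..r. part_size r \<sigma> t k)"
    by (rule sum_mono2) (use assms in auto)
  then show ?thesis using part_size_sum[OF assms(1), of t] by (auto simp: part_def)
qed

lemma part_disjoint:
  assumes "i \<noteq> j"
  shows "part r \<sigma> t i \<inter> part r \<sigma> t j = {}"
proof -
  have "part r \<sigma> t i \<inter> part r \<sigma> t j = {}" if "i < j" for i j
  proof -
    have "(\<Sum>k=1..i. part_size r \<sigma> t k) \<le> (\<Sum>k=1..<j. part_size r \<sigma> t k)"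
      by (rule sum_mono2) (use that in auto)
    then show ?thesis by (auto simp: part_def)
  qed
  then show ?thesis using assms by (metis inf_commute nat_neq_iff)
qed

section \<open>Members of the class as sets of pairs with prescribed block counts\<close>

lemma simple_graph_iff_pairs:
  "simple_graph H \<longleftrightarrow> finite (verts H) \<and> edges H \<subseteq> pairs_between (verts H) (verts H)"
  by (simp add: simple_graph_def pairs_between_def)

lemma finite_graph_class: "finite (graph_class r \<sigma> D t d)"
  by (rule finite_subset[of _ "{{1..t}} \<times> Pow (pairs_between {1..t} {1..t})"])
     (auto simp: graph_class_def simple_graph_iff_pairs finite_pairs_between)

lemma edges_between_eq:
  assumes "simple_graph H"
  shows "edges_between H S T = edges H \<inter> pairs_between S T"
proof -
  have "u \<noteq> v" if "{u, v} \<in> edges H" for u v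
    using that assms by (fastforce simp: simple_graph_def doubleton_eq_iff)
  then show ?thesis by (fastforce simp: edges_between_def pairs_between_def)
qed

text \<open>Pairs are unordered, so ordering the indices of a block is what prevents one block from
  being listed twice.\<close>

lemma pairs_between_parts_disjoint:
  assumes "i \<le> j" "i' \<le> j'" "(i, j) \<noteq> (i', j')"
  shows "pairs_between (part r \<sigma> t i) (part r \<sigma> t j) \<inter> pairs_between (part r \<sigma> t i') (part r \<sigma> t j') = {}"
proof (rule ccontr)
  assume "\<not> ?thesis"
  then obtain u v u' v' where uv: "u \<in> part r \<sigma> t i" "v \<in> part r \<sigma> t j"
      "u' \<in> part r \<sigma> t i'" "v' \<in> part r \<sigma> t j'" "{u, v} = {u', v'}"
    unfolding pairs_between_def by blast
  have eq: "a = b" if "x \<in> part r \<sigma> t a" "x \<in> part r \<sigma> t b" for x a b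
    using part_disjoint[of a b r \<sigma> t] that by blast
  from uv(5) consider "u = u'" "v = v'" | "u = v'" "v = u'" by (auto simp: doubleton_eq_iff)
  then show False
  proof cases
    case 1
    then show ?thesis using eq uv assms by blast
  next
    case 2
    then have "i = j'" "j = i'" using eq uv by blast+
    then show ?thesis using assms by simp
  qed
qed

text \<open>In a uniform member of the class the edges between the two parts form a uniform set of
  prescribed size among the pairs there, whatever the other edges are, so
  \<open>binomial_diff_le\<close> applies. The number of pairs is then bounded by
  \<open>(real t)\<^sup>2\<close>. The formulation by counts also covers an empty class.\<close>

lemma card_class_avoiding_le:
  assumes \<sigma>: "weight_vector r \<sigma>" and ij: "i \<in> {1..r}" "j \<in> {i..r}"
    and Z: "Z \<subseteq> pairs_between (part r \<sigma> t i) (part r \<sigma> t j)"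
  shows "real (card {H \<in> graph_class r \<sigma> D t d. edges H \<inter> Z = {}}) \<le>
    exp (- (real (card Z) / (real t)\<^sup>2 * real_of_int \<lfloor>real t * epowr d (D i j)\<rfloor>)) *
      real (card (graph_class r \<sigma> D t d))"
proof -
  let ?P = "\<lambda>i j. pairs_between (part r \<sigma> t i) (part r \<sigma> t j)"
  let ?\<Omega> = "pairs_between {1..t} {1..t}" and ?A = "?P i j" and ?F = "\<lambda>i j. \<lfloor>real t * epowr d (D i j)\<rfloor>"
  define M where "M = nat (?F i j)"
  have M: "?F i j = int M" unfolding M_def epowr_def by simp
  \<comment> \<open>\<open>Q\<close> collects the edge counts of all other blocks. These are
    disjoint from \<open>?A\<close>, so \<open>Q\<close> depends only on the edges outside
    \<open>?A\<close>.\<close>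
  define Q where "Q R \<longleftrightarrow> (\<forall>i'\<in>{1..r}. \<forall>j'\<in>{i'..r}. (i', j') \<noteq> (i, j) \<longrightarrow> int (card (R \<inter> ?P i' j')) = ?F i' j')"
    for R :: "nat set set"
  have PA: "?P i' j' \<inter> ?A = {}" if "i' \<in> {1..r}" "j' \<in> {i'..r}" "(i', j') \<noteq> (i, j)" for i' j'
    using pairs_between_parts_disjoint[of i' j' i j r \<sigma> t] that ij by simp
  have QE: "Q (E - ?A) \<longleftrightarrow> Q E" for E
  proof -
    have "(E - ?A) \<inter> ?P i' j' = E \<inter> ?P i' j'" if "i' \<in> {1..r}" "j' \<in> {i'..r}" "(i', j') \<noteq> (i, j)" for i' j'
      using PA[OF that] by blast
    then show ?thesis by (simp add: Q_def)
  qed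
  have fin: "finite ?\<Omega>" by (simp add: finite_pairs_between)
  have A: "?A \<subseteq> ?\<Omega>"
    using part_subset[OF \<sigma>, of i t] part_subset[OF \<sigma>, of j t] ij
    unfolding pairs_between_def by fastforce
  have cls: "card {H \<in> graph_class r \<sigma> D t d. edges H \<inter> Z' = {}} =
      card {E. E \<subseteq> ?\<Omega> \<and> E \<inter> ?A \<subseteq> ?A - Z' \<and> card (E \<inter> ?A) = M \<and> Q (E - ?A)}"
    if Z': "Z' \<subseteq> ?A" for Z'
  proof -
    have "{H \<in> graph_class r \<sigma> D t d. edges H \<inter> Z' = {}} =
      Pair {1..t} ` {E. E \<subseteq> ?\<Omega> \<and> E \<inter> ?A \<subseteq> ?A - Z' \<and> card (E \<inter> ?A) = M \<and> Q (E - ?A)}"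
    proof -
      have "H \<in> graph_class r \<sigma> D t d \<longleftrightarrow> verts H = {1..t} \<and> edges H \<subseteq> ?\<Omega> \<and>
          card (edges H \<inter> ?A) = M \<and> Q (edges H)" for H
      proof -
        have "H \<in> graph_class r \<sigma> D t d \<longleftrightarrow> simple_graph H \<and> verts H = {1..t} \<and>
          (\<forall>i\<in>{1..r}. \<forall>j\<in>{i..r}. int (card (edges H \<inter> ?P i j)) = ?F i j)"
          unfolding graph_class_def using edges_between_eq[of H] by auto
        also have "\<dots> \<longleftrightarrow> simple_graph H \<and> verts H = {1..t} \<and> int (card (edges H \<inter> ?A)) = ?F i j \<and> Q (edges H)"
          unfolding Q_def using ij by auto
        also have "\<dots> \<longleftrightarrow> verts H = {1..t} \<and> edges H \<subseteq> ?\<Omega> \<and> card (edges H \<inter> ?A) = M \<and> Q (edges H)"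
          unfolding simple_graph_iff_pairs M by auto
        finally show ?thesis .
      qed
      moreover have "E \<inter> Z' = {} \<longleftrightarrow> E \<inter> ?A \<subseteq> ?A - Z'" for E using Z' by blast
      ultimately show ?thesis by (auto simp: QE image_iff)
    qed
    then show ?thesis by (simp add: card_image inj_on_def)
  qed
  let ?R = "card {R. R \<subseteq> ?\<Omega> - ?A \<and> Q R}"
  have all: "card (graph_class r \<sigma> D t d) = (card ?A choose M) * ?R"
    using cls[of "{}"] card_fixed_trace[OF fin order.refl A, of M Q] by simp
  have finA: "finite ?A" using A fin by (rule finite_subset)
  have "card {H \<in> graph_class r \<sigma> D t d. edges H \<inter> Z = {}} = (card (?A - Z) choose M) * ?R"
    using cls[OF Z] card_fixed_trace[OF fin _ A, of "?A - Z" M Q] by simp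
  also have "card (?A - Z) = card ?A - card Z"
    by (rule card_Diff_subset) (use Z finA in \<open>auto intro: finite_subset\<close>)
  finally have avoid: "card {H \<in> graph_class r \<sigma> D t d. edges H \<inter> Z = {}} =
    ((card ?A - card Z) choose M) * ?R" .
  have ZA: "card Z \<le> card ?A" using Z finA by (rule card_mono[rotated])
  have "card ?A \<le> t choose 2"
    using card_mono[OF fin A] card_pairs_between_same[of "{1..t}"] by simp
  also have "\<dots> \<le> t * (t - 1)" unfolding choose_two by (rule div_le_dividend)
  also have "\<dots> \<le> t\<^sup>2" by (simp add: power2_eq_square)
  finally have At: "real (card ?A) \<le> (real t)\<^sup>2" by (metis of_nat_le_iff of_nat_power)
  \<comment> \<open>If \<open>?A\<close> is empty then so is \<open>Z\<close>, and both quotients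
    are 0.\<close>
  have "real (card Z) / (real t)\<^sup>2 \<le> real (card Z) / real (card ?A)"
  proof (cases "card ?A = 0")
    case False
    then have "0 < real (card ?A)" by simp
    moreover from this have "0 < (real t)\<^sup>2" using At by linarith
    ultimately show ?thesis using At by (intro divide_left_mono mult_pos_pos) auto
  qed (use ZA in simp)
  then have le: "exp (- (real (card Z) / real (card ?A) * real M)) \<le> exp (- (real (card Z) / (real t)\<^sup>2 * real M))"
    using mult_right_mono[OF _ of_nat_0_le_iff, of _ _ M]
    by (simp only: exp_le_cancel_iff neg_le_iff_le)
  have "real (card {H \<in> graph_class r \<sigma> D t d. edges H \<inter> Z = {}}) =
      real ((card ?A - card Z) choose M) * real ?R" unfolding avoid by simp
  also have "\<dots> \<le> (exp (- (real (card Z) / real (card ?A) * real M)) * real (card ?A choose M)) * real ?R"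
    by (intro mult_right_mono binomial_diff_le ZA) simp
  also have "\<dots> \<le> exp (- (real (card Z) / (real t)\<^sup>2 * real M)) * (real (card ?A choose M) * real ?R)"
    using le by (simp add: mult_right_mono mult.assoc)
  finally show ?thesis unfolding all M by simp
qed

section \<open>The optimization problem\<close>

lemma gamma_weight_le:
  assumes \<sigma>: "weight_vector r \<sigma>"
    and \<beta>: "\<And>i. i \<in> {1..r} \<Longrightarrow> 0 \<le> \<beta> i"
      "\<And>i j. i \<in> {1..r} \<Longrightarrow> j \<in> {1..r} \<Longrightarrow> D i j \<le> ereal (\<beta> i * \<beta> j)"
  shows "gamma_weight r \<sigma> D \<le> (\<Sum>i=1..r. \<sigma> i * \<beta> i)"
  unfolding gamma_weight_def
proof (rule cInf_lower)
  show "bdd_below {\<Sum>i=1..r. \<sigma> i * \<beta> i | \<beta> :: nat \<Rightarrow> real.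
            (\<forall>i\<in>{1..r}. 0 \<le> \<beta> i) \<and> (\<forall>i\<in>{1..r}. \<forall>j\<in>{1..r}. D i j \<le> ereal (\<beta> i * \<beta> j))}"
    using \<sigma> by (intro bdd_belowI[of _ 0]) (auto simp: weight_vector_def intro!: sum_nonneg)
qed (use \<beta> in blast)

lemma gamma_weight_le_1:
  assumes "weight_vector r \<sigma>" "exponent_matrix r D"
  shows "gamma_weight r \<sigma> D \<le> 1"
  using gamma_weight_le[of r \<sigma> "\<lambda>_. 1" D] assms
  by (simp add: weight_vector_def exponent_matrix_def one_ereal_def)

text \<open>Markov's inequality: at most a fraction \<open>1 / (1 + \<kappa>)\<close> of
  \<open>S\<close> lies above \<open>1 + \<kappa>\<close> times the average. The argument cancels
  the average, so the sum 0 is a separate case.\<close>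

lemma many_below_average:
  fixes b :: "'a \<Rightarrow> nat" and \<kappa> :: real
  assumes S: "finite S" and \<kappa>: "0 < \<kappa>"
  shows "\<kappa> * real (card S) \<le>
    (1 + \<kappa>) * real (card {u \<in> S. real (b u) \<le> (1 + \<kappa>) * (real (\<Sum>u\<in>S. b u) / real (card S))})"
proof (cases "(\<Sum>u\<in>S. b u) = 0")
  case True
  then have "{u \<in> S. real (b u) \<le> (1 + \<kappa>) * (real (\<Sum>u\<in>S. b u) / real (card S))} = S"
    using S by auto
  then show ?thesis using \<kappa> by (simp add: algebra_simps)
next
  case False
  define a where "a = real (\<Sum>u\<in>S. b u) / real (card S)"
  have S0: "0 < card S" using False S by (auto simp: card_gt_0_iff)
  have a: "0 < a" using False S0 by (simp add: a_def divide_simps del: of_nat_sum)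
  let ?T = "{u \<in> S. (1 + \<kappa>) * a < real (b u)}" and ?U = "{u \<in> S. real (b u) \<le> (1 + \<kappa>) * a}"
  have "real (card ?T) * ((1 + \<kappa>) * a) = (\<Sum>u\<in>?T. (1 + \<kappa>) * a)" by simp
  also have "\<dots> \<le> (\<Sum>u\<in>?T. real (b u))" by (rule sum_mono) auto
  also have "\<dots> \<le> (\<Sum>u\<in>S. real (b u))" by (rule sum_mono2) (use S in auto)
  also have "\<dots> = real (card S) * a" using S0 by (simp add: a_def)
  finally have "real (card ?T) * (1 + \<kappa>) \<le> real (card S)" using a by simp
  moreover have "card S = card ?T + card ?U"
  proof -
    have "S = ?T \<union> ?U" by auto
    moreover have "card (?T \<union> ?U) = card ?T + card ?U"
      by (rule card_Un_disjoint) (use S in auto)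
    ultimately show ?thesis by simp
  qed
  ultimately have "\<kappa> * real (card S) \<le> (1 + \<kappa>) * real (card ?U)"
    by (simp add: algebra_simps)
  then show ?thesis by (simp add: a_def)
qed

text \<open>\<open>\<beta> i * L\<close> is \<open>1 + \<kappa>\<close> times the mean of
  \<open>b\<close> on the \<open>i\<close>-th part. The weighted sum of \<open>\<beta>\<close> is at
  most \<open>1 - 2 * \<kappa>\<close> times gamma, so it stays below gamma even after adding
  \<open>\<kappa> * \<epsilon>\<close> to every entry. The shifted vector is therefore inadmissible,
  and where it fails, \<open>D i j\<close> exceeds a product that is at least
  \<open>\<beta> i * \<beta> j + (\<kappa> * \<epsilon>)\<^sup>2\<close>.\<close>

lemma exists_dense_pair:
  assumes \<sigma>: "weight_vector r \<sigma>" "\<And>i. i \<in> {1..r} \<Longrightarrow> \<epsilon> < \<sigma> i" and \<epsilon>: "0 < \<epsilon>"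
    and D: "exponent_matrix r D" and \<gamma>: "\<epsilon> \<le> gamma_weight r \<sigma> D"
    and \<kappa>: "0 < \<kappa>" "\<kappa> \<le> 1 / 8" and t: "2 \<le> \<kappa> * \<epsilon> * real t" and L: "0 < L"
    and b: "real (\<Sum>u\<in>{1..t}. b u) \<le> (1 - 4 * \<kappa>) * gamma_weight r \<sigma> D * real t * L"
  obtains i j x y where "i \<in> {1..r}" "j \<in> {i..r}" "0 \<le> x" "0 \<le> y" "x \<le> 1 / \<epsilon>" "y \<le> 1 / \<epsilon>"
    "ereal (x * y + (\<kappa> * \<epsilon>)\<^sup>2) \<le> D i j"
    "\<kappa> * \<epsilon> / 4 * real t \<le> real (card {u \<in> part r \<sigma> t i. real (b u) \<le> x * L})"
    "\<kappa> * \<epsilon> / 4 * real t \<le> real (card {u \<in> part r \<sigma> t j. real (b u) \<le> y * L})"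
proof -
  let ?\<gamma> = "gamma_weight r \<sigma> D" and ?P = "part r \<sigma> t"
  have t0: "0 < real t" using t by (cases "t = 0") auto
  define \<beta> where "\<beta> i = (1 + \<kappa>) * (real (\<Sum>u\<in>?P i. b u) / real (card (?P i))) / L" for i
  have \<beta>0: "0 \<le> \<beta> i" for i using \<kappa> L by (simp add: \<beta>_def sum_nonneg)
  \<comment> \<open>Rounding loses less than one vertex of a part, and \<open>t\<close> is large
    enough for the factor \<open>1 + \<kappa>\<close> to make up for it.\<close>
  have size: "\<sigma> i * real t \<le> (1 + \<kappa>) * real (card (?P i))" if i: "i \<in> {1..r}" for i
  proof -
    have "\<kappa> * \<epsilon> * real t \<le> \<kappa> * \<sigma> i * real t"
      using \<sigma>(2)[OF i] \<kappa> by (intro mult_right_mono mult_left_mono) auto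
    then have "1 + \<kappa> \<le> \<kappa> * (\<sigma> i * real t)" using t \<kappa> unfolding mult.assoc by linarith
    moreover have "(1 + \<kappa>) * (\<sigma> i * real t - 1) \<le> (1 + \<kappa>) * real (card (?P i))"
      using part_size_ge[of \<sigma> i t r] i \<kappa> by (intro mult_left_mono) (auto simp: card_part)
    ultimately show ?thesis by (simp add: algebra_simps)
  qed
  have size0: "0 < real (card (?P i))" if i: "i \<in> {1..r}" for i
  proof -
    have "0 < \<sigma> i * real t" using \<sigma>(2)[OF i] \<epsilon> t0 by simp
    then have "0 < (1 + \<kappa>) * real (card (?P i))" using size[OF i] by linarith
    then show ?thesis using \<kappa> by (simp add: zero_less_mult_iff)
  qed
  have fin: "finite (?P i)" for i by (simp add: part_def)
  have many: "\<kappa> * \<epsilon> / 4 * real t \<le> real (card {u \<in> ?P i. real (b u) \<le> \<beta> i * L})"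
    if i: "i \<in> {1..r}" for i
  proof -
    let ?c = "real (card {u \<in> ?P i. real (b u) \<le> \<beta> i * L})"
    have "\<kappa> * real (card (?P i)) \<le> (1 + \<kappa>) * ?c"
      using many_below_average[OF fin \<kappa>(1), of i b] L by (simp add: \<beta>_def)
    then have "(1 + \<kappa>) * (\<kappa> * real (card (?P i))) \<le> (1 + \<kappa>) * ((1 + \<kappa>) * ?c)"
      using \<kappa> by (intro mult_left_mono) auto
    then have "\<kappa> * ((1 + \<kappa>) * real (card (?P i))) \<le> (1 + \<kappa>)\<^sup>2 * ?c"
      by (simp only: power2_eq_square mult_ac)
    moreover have "\<kappa> * (\<epsilon> * real t) \<le> \<kappa> * ((1 + \<kappa>) * real (card (?P i)))"
      using size[OF i] mult_right_mono[OF less_imp_le[OF \<sigma>(2)[OF i]], of "real t"] \<kappa>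
      by (intro mult_left_mono) auto
    moreover have "(1 + \<kappa>)\<^sup>2 * ?c \<le> 2\<^sup>2 * ?c"
      using \<kappa> by (intro mult_right_mono power_mono) auto
    ultimately show ?thesis by simp
  qed
  \<comment> \<open>One factor \<open>1 + \<kappa>\<close> comes from the rounding of the parts, the
    other from the definition of \<open>\<beta>\<close>.\<close>
  have "(\<Sum>i=1..r. \<sigma> i * \<beta> i) \<le> (\<Sum>i=1..r. (1 + \<kappa>)\<^sup>2 / (real t * L) * real (\<Sum>u\<in>?P i. b u))"
  proof (rule sum_mono)
    fix i assume i: "i \<in> {1..r}"
    have "\<sigma> i * \<beta> i \<le> ((1 + \<kappa>) * real (card (?P i)) / real t) * \<beta> i"
      using size[OF i] \<beta>0 t0 by (intro mult_right_mono) (auto simp: field_simps)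
    also have "\<dots> = (1 + \<kappa>)\<^sup>2 / (real t * L) * real (\<Sum>u\<in>?P i. b u)"
    proof -
      have "(1 + \<kappa>) * c / real t * ((1 + \<kappa>) * (S / c) / L) = (1 + \<kappa>)\<^sup>2 / (real t * L) * S"
        if "0 < c" for c S :: real
        using that by (simp add: power2_eq_square)
      from this[OF size0[OF i]] show ?thesis by (simp only: \<beta>_def)
    qed
    finally show "\<sigma> i * \<beta> i \<le> (1 + \<kappa>)\<^sup>2 / (real t * L) * real (\<Sum>u\<in>?P i. b u)" .
  qed
  also have "\<dots> = (1 + \<kappa>)\<^sup>2 / (real t * L) * real (\<Sum>i=1..r. \<Sum>u\<in>?P i. b u)"
    by (simp add: sum_distrib_left)
  also have "(\<Sum>i=1..r. \<Sum>u\<in>?P i. b u) = (\<Sum>u\<in>(\<Union>i\<in>{1..r}. ?P i). b u)"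
    by (rule sum.UNION_disjoint[symmetric]) (use fin part_disjoint in auto)
  also have "(1 + \<kappa>)\<^sup>2 / (real t * L) * real \<dots> \<le> (1 + \<kappa>)\<^sup>2 / (real t * L) * real (\<Sum>u\<in>{1..t}. b u)"
  proof -
    have "(\<Sum>u\<in>(\<Union>i\<in>{1..r}. ?P i). b u) \<le> (\<Sum>u\<in>{1..t}. b u)"
      by (rule sum_mono2[OF _ UN_least[OF part_subset[OF \<sigma>(1)]]]) auto
    then show ?thesis using L t0 by (intro mult_left_mono) (simp_all del: of_nat_sum)
  qed
  also have "\<dots> \<le> (1 + \<kappa>)\<^sup>2 / (real t * L) * ((1 - 4 * \<kappa>) * ?\<gamma> * real t * L)"
    using b L t0 by (intro mult_left_mono) auto
  also have "\<dots> = ((1 + \<kappa>)\<^sup>2 * (1 - 4 * \<kappa>)) * ?\<gamma>"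
    using L t0 by (simp add: field_simps)
  also have "\<dots> \<le> (1 - 2 * \<kappa>) * ?\<gamma>"
  proof -
    have "(1 + \<kappa>)\<^sup>2 * (1 - 4 * \<kappa>) = 1 - 2 * \<kappa> - 7 * \<kappa>\<^sup>2 - 4 * \<kappa> ^ 3"
      by (simp add: power2_eq_square power3_eq_cube algebra_simps)
    also have "\<dots> \<le> 1 - 2 * \<kappa>" using zero_le_power[of \<kappa> 2] zero_le_power[of \<kappa> 3] \<kappa> by linarith
    finally show ?thesis using \<gamma> \<epsilon> by (intro mult_right_mono) auto
  qed
  finally have sum\<beta>: "(\<Sum>i=1..r. \<sigma> i * \<beta> i) \<le> (1 - 2 * \<kappa>) * ?\<gamma>" .
  \<comment> \<open>Every weight exceeds \<open>\<epsilon>\<close>, so the weighted sum controls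
    each entry. This caps the branch sets of interest at size \<open>L / \<epsilon>\<close>.\<close>
  have \<beta>1: "\<beta> i \<le> 1 / \<epsilon>" if i: "i \<in> {1..r}" for i
  proof -
    have "\<epsilon> * \<beta> i \<le> \<sigma> i * \<beta> i" using \<sigma>(2)[OF i] \<beta>0 by (intro mult_right_mono) auto
    also have "\<dots> \<le> (\<Sum>i=1..r. \<sigma> i * \<beta> i)"
      using i \<sigma>(1) \<beta>0 by (intro member_le_sum) (auto simp: weight_vector_def)
    also note sum\<beta>
    also have "(1 - 2 * \<kappa>) * ?\<gamma> \<le> 1 * ?\<gamma>"
      using \<gamma> \<epsilon> \<kappa> by (intro mult_right_mono) auto
    also have "\<dots> \<le> 1" using gamma_weight_le_1[OF \<sigma>(1) D] by simp
    finally show ?thesis using \<epsilon> by (simp add: field_simps)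
  qed
  have "\<exists>i\<in>{1..r}. \<exists>j\<in>{1..r}. ereal (\<beta> i * \<beta> j + (\<kappa> * \<epsilon>)\<^sup>2) \<le> D i j"
  proof (rule ccontr)
    assume neg: "\<not> ?thesis"
    have "?\<gamma> \<le> (\<Sum>i=1..r. \<sigma> i * (\<beta> i + \<kappa> * \<epsilon>))"
    proof (rule gamma_weight_le[OF \<sigma>(1)])
      show "0 \<le> \<beta> i + \<kappa> * \<epsilon>" for i using \<beta>0[of i] \<kappa> \<epsilon> by simp
      fix i j assume ij: "i \<in> {1..r}" "j \<in> {1..r}"
      have "D i j \<le> ereal (\<beta> i * \<beta> j + (\<kappa> * \<epsilon>)\<^sup>2)" using neg ij by (meson linear)
      also have "\<dots> \<le> ereal ((\<beta> i + \<kappa> * \<epsilon>) * (\<beta> j + \<kappa> * \<epsilon>))"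
      proof -
        have "0 \<le> \<beta> i * (\<kappa> * \<epsilon>) + \<beta> j * (\<kappa> * \<epsilon>)" using \<beta>0 \<kappa> \<epsilon> by simp
        then show ?thesis by (simp add: algebra_simps power2_eq_square)
      qed
      finally show "D i j \<le> ereal ((\<beta> i + \<kappa> * \<epsilon>) * (\<beta> j + \<kappa> * \<epsilon>))" .
    qed
    also have "\<dots> = (\<Sum>i=1..r. \<sigma> i * \<beta> i) + (\<Sum>i=1..r. \<sigma> i) * (\<kappa> * \<epsilon>)"
      by (simp add: distrib_left sum.distrib sum_distrib_right)
    also have "\<dots> \<le> (1 - 2 * \<kappa>) * ?\<gamma> + \<kappa> * ?\<gamma>"
      using sum\<beta> \<sigma>(1) \<gamma> \<kappa> by (auto simp: weight_vector_def intro!: add_mono)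
    also have "\<dots> = ?\<gamma> - \<kappa> * ?\<gamma>" by (simp add: algebra_simps)
    also have "\<dots> < ?\<gamma>" using \<gamma> \<epsilon> \<kappa> by simp
    finally show False by simp
  qed
  then obtain i j where ij: "i \<in> {1..r}" "j \<in> {1..r}" "ereal (\<beta> i * \<beta> j + (\<kappa> * \<epsilon>)\<^sup>2) \<le> D i j"
    by blast
  show ?thesis
  proof (cases "i \<le> j")
    case True
    then show ?thesis using that[of i j "\<beta> i" "\<beta> j"] ij \<beta>0 \<beta>1 many by simp
  next
    case False
    have "D i j = D j i" using D ij by (auto simp: exponent_matrix_def)
    then show ?thesis using False that[of j i "\<beta> j" "\<beta> i"] ij \<beta>0 \<beta>1 many
      by (simp add: mult.commute)
  qed
qed

section \<open>The union bound\<close>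

text \<open>An unordered pair comes from at most two ordered ones; both can occur when the two
  families lie in the same part.\<close>

lemma card_doubleton_image_ge:
  assumes "finite P" "\<And>u v. (u, v) \<in> P \<Longrightarrow> u \<noteq> v"
  shows "card P \<le> 2 * card ((\<lambda>(u, v). {u, v}) ` P)"
proof -
  let ?f = "\<lambda>(u, v). {u, v}"
  have "card P = (\<Sum>e\<in>?f ` P. card {a \<in> P. ?f a = e})"
    using sum.image_gen[OF assms(1), of "\<lambda>_. 1" ?f] by (simp only: card_eq_sum)
  also have "\<dots> \<le> (\<Sum>e\<in>?f ` P. 2)"
  proof (rule sum_mono)
    fix e assume "e \<in> ?f ` P"
    then obtain u v where e: "e = {u, v}" by auto
    have "{a \<in> P. ?f a = e} \<subseteq> {(u, v), (v, u)}"
    proof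
      fix a assume a: "a \<in> {a \<in> P. ?f a = e}"
      obtain x y where xy: "a = (x, y)" by (cases a)
      then have "{x, y} = {u, v}" using a e by simp
      then show "a \<in> {(u, v), (v, u)}" unfolding xy by (auto simp: doubleton_eq_iff)
    qed
    then have "card {a \<in> P. ?f a = e} \<le> card {(u, v), (v, u)}" by (rule card_mono[rotated]) simp
    also have "\<dots> \<le> 2" by (rule order.trans[OF card_insert_le_m1]) auto
    finally show "card {a \<in> P. ?f a = e} \<le> 2" .
  qed
  finally show ?thesis by simp
qed

text \<open>The empty set stands for a forgotten branch set, which says nothing about edges.\<close>

definition anticomplete_pairs ::
    "nat set set \<Rightarrow> (nat \<Rightarrow> nat set) \<Rightarrow> nat set \<Rightarrow> nat set \<Rightarrow> nat set set" where
  "anticomplete_pairs E X S T =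
     {{u, v} | u v. u \<in> S \<and> v \<in> T \<and> u \<noteq> v \<and> X u \<noteq> {} \<and> X v \<noteq> {} \<and> anticomplete E (X u) (X v)}"

lemma anticomplete_pairs_subset: "anticomplete_pairs E X S T \<subseteq> pairs_between S T"
  unfolding anticomplete_pairs_def pairs_between_def by blast

text \<open>Since \<open>exp (- l)\<close> to the power \<open>x * y * L\<^sup>2\<close> is
  \<open>d powr (- (x * y))\<close>, spreading can be applied with \<open>m\<close> about
  \<open>K * d powr (\<Delta> - ?e)\<close>. A fraction of order \<open>1 / m\<close> of the pairs
  between the two families is then anticomplete. Multiplied by about
  \<open>t * d powr \<Delta>\<close> edges, this loses its dependence on \<open>\<Delta>\<close> and
  leaves \<open>t * d powr ?e / K\<close> up to constants, the same bound for all index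
  pairs.\<close>

lemma minor_avoids_anticomplete_pairs:
  assumes \<sigma>: "weight_vector r \<sigma>" "\<And>i. i \<in> {1..r} \<Longrightarrow> \<epsilon> < \<sigma> i" and \<epsilon>: "0 < \<epsilon>"
    and D: "exponent_matrix r D" and \<gamma>: "\<epsilon> \<le> gamma_weight r \<sigma> D"
    and \<kappa>: "0 < \<kappa>" "\<kappa> \<le> 1 / 8" and t: "2 \<le> \<kappa> * \<epsilon> * real t" and L: "0 < L"
    and d: "1 < d" and l: "0 < l" "l * L\<^sup>2 = ln d" and N: "0 < N"
    and E: "spreads_nonedges {..<N} s (exp (- l)) K E" and K: "1 \<le> K"
    and s: "\<And>n. real n \<le> L / \<epsilon> \<Longrightarrow> n \<le> s"
    and Nk: "real (N * k) \<le> (1 - 4 * \<kappa>) * gamma_weight r \<sigma> D * real t * L"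
    and few: "8 * K * d powr (1 - (\<kappa> * \<epsilon>)\<^sup>2) * real (k * s) < \<kappa> * \<epsilon> / 4 * real t"
    and H: "verts H = {1..t}" "is_minor H (blowup N k E)"
  shows "\<exists>X\<in>PiE {1..t} (\<lambda>_. {A. A \<subseteq> {..<N} \<and> card A \<le> s}). \<exists>i\<in>{1..r}. \<exists>j\<in>{i..r}.
    (\<kappa> * \<epsilon> / 4)\<^sup>2 * real t * d powr ((\<kappa> * \<epsilon>)\<^sup>2) / (32 * K) \<le>
      real (card (anticomplete_pairs E X (part r \<sigma> t i) (part r \<sigma> t j))) / (real t)\<^sup>2 *
      real_of_int \<lfloor>real t * epowr d (D i j)\<rfloor> \<and>
    edges H \<inter> anticomplete_pairs E X (part r \<sigma> t i) (part r \<sigma> t j) = {}"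
proof -
  let ?c = "\<kappa> * \<epsilon> / 4" and ?P = "part r \<sigma> t" and ?e = "(\<kappa> * \<epsilon>)\<^sup>2"
  have finH: "finite (verts H)" by (simp add: H(1))
  obtain X b where
      X: "\<And>u. u \<in> {1..t} \<Longrightarrow> X u \<subseteq> {..<N} \<and> X u \<noteq> {} \<and> card (X u) \<le> b u"
    and b: "(\<Sum>u\<in>{1..t}. b u) \<le> N * k"
    and mult: "\<And>v. card {u \<in> {1..t}. v \<in> X u} \<le> k"
    and edge: "\<And>u v. u \<in> {1..t} \<Longrightarrow> v \<in> {1..t} \<Longrightarrow> {u, v} \<in> edges H \<Longrightarrow> \<not> anticomplete E (X u) (X v)"
    by (rule minor_of_blowup[OF H(2) finH N, unfolded H(1)]) (rule that; simp)
  have "real (\<Sum>u\<in>{1..t}. b u) \<le> real (N * k)" using b by (simp only: of_nat_le_iff)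
  also note Nk
  finally have b': "real (\<Sum>u\<in>{1..t}. b u) \<le> (1 - 4 * \<kappa>) * gamma_weight r \<sigma> D * real t * L" .
  obtain i j x y where ij: "i \<in> {1..r}" "j \<in> {i..r}" and xy: "0 \<le> x" "0 \<le> y" "x \<le> 1 / \<epsilon>" "y \<le> 1 / \<epsilon>"
    and Dij: "ereal (x * y + ?e) \<le> D i j"
    and U: "?c * real t \<le> real (card {u \<in> ?P i. real (b u) \<le> x * L})"
    and U': "?c * real t \<le> real (card {u \<in> ?P j. real (b u) \<le> y * L})"
    by (rule exists_dense_pair[OF \<sigma> \<epsilon> D \<gamma> \<kappa> t L b']) (assumption, (rule that; assumption))
  let ?U = "{u \<in> ?P i. real (b u) \<le> x * L}" and ?U' = "{u \<in> ?P j. real (b u) \<le> y * L}"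
  have j: "j \<in> {1..r}" using ij by simp
  have Psub: "?P i \<subseteq> {1..t}" "?P j \<subseteq> {1..t}" using part_subset[OF \<sigma>(1)] ij(1) j by auto
  have t0: "0 < real t" using t by (cases "t = 0") auto
  have D1: "D i j \<le> 1" using D ij(1) j by (auto simp: exponent_matrix_def)
  \<comment> \<open>\<open>D i j\<close> lies between a real number and 1, so it is finite.\<close>
  define \<Delta> where "\<Delta> = real_of_ereal (D i j)"
  have D\<Delta>: "D i j = ereal \<Delta>"
    using Dij D1 unfolding \<Delta>_def by (cases "D i j") (auto simp: one_ereal_def)
  have \<Delta>: "x * y + ?e \<le> \<Delta>" "\<Delta> \<le> 1" using Dij D1 by (simp_all add: D\<Delta> one_ereal_def)
  have xy0: "0 \<le> x * y" using xy by simp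
  let ?q = "d powr (\<Delta> - ?e)"
  have q1: "1 \<le> ?q" using d \<Delta> xy0 by (simp add: ge_one_powr_ge_zero)
  \<comment> \<open>The rounded number is at least 1, so rounding up at most doubles it.\<close>
  define m where "m = nat \<lceil>K * ?q\<rceil>"
  have Kq: "1 \<le> K * ?q" using K q1 by (metis mult_1 mult_mono' zero_le_one)
  have m: "K * ?q \<le> real m" "real m \<le> 2 * K * ?q" "0 < m"
    using Kq unfolding m_def by linarith+
  have bs: "b u \<le> s" if "u \<in> ?U \<union> ?U'" for u
  proof (rule s)
    have "x * L \<le> 1 / \<epsilon> * L" "y * L \<le> 1 / \<epsilon> * L" using xy L by (intro mult_right_mono; simp)+
    then show "real (b u) \<le> L / \<epsilon>" using that by auto
  qed
  have Xsmall: "X u \<in> small_sets {..<N} s" if "u \<in> ?U \<union> ?U'" for u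
    using X[of u] bs[OF that] that Psub unfolding small_sets_def by fastforce
  have Kpair: "K \<le> real m * exp (- l) ^ (card (X u) * card (X v))" if uv: "u \<in> ?U" "v \<in> ?U'" for u v
  proof -
    have "real (card (X u)) \<le> x * L" "real (card (X v)) \<le> y * L"
      using X[of u] X[of v] uv Psub by fastforce+
    then have "real (card (X u)) * real (card (X v)) \<le> (x * L) * (y * L)"
      using xy L by (intro mult_mono) auto
    then have "l * (real (card (X u)) * real (card (X v))) \<le> l * ((x * L) * (y * L))"
      using l by (intro mult_left_mono) auto
    also have "\<dots> = (x * y) * ln d" using l(2) by (simp add: power2_eq_square algebra_simps)
    also have "\<dots> \<le> (\<Delta> - ?e) * ln d" using \<Delta> d by (intro mult_right_mono) auto
    finally have "exp (- ((\<Delta> - ?e) * ln d)) \<le> exp (- (l * (real (card (X u)) * real (card (X v)))))"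
      by simp
    also have "exp (- ((\<Delta> - ?e) * ln d)) = 1 / ?q"
      using d by (simp add: powr_def exp_minus inverse_eq_divide)
    also have "exp (- (l * (real (card (X u)) * real (card (X v))))) = exp (- l) ^ (card (X u) * card (X v))"
      by (simp add: exp_of_nat_mult[symmetric] mult_ac)
    finally have "real m * (1 / ?q) \<le> real m * exp (- l) ^ (card (X u) * card (X v))"
      by (intro mult_left_mono) auto
    moreover have "K \<le> real m / ?q" using m(1) q1 by (subst pos_le_divide_eq) auto
    ultimately show ?thesis by simp
  qed
  \<comment> \<open>As \<open>\<Delta> \<le> 1\<close>, \<open>m\<close> is at most
    \<open>2 * K * d powr (1 - ?e)\<close>; the hypothesis \<open>few\<close> thus settles the size
    conditions for both families.\<close>
  have big: "4 * k * m * s < card Z" if "?c * real t \<le> real (card Z)" for Z :: "nat set"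
  proof -
    have "real (4 * k * m * s) = 4 * real m * real (k * s)" by simp
    also have "\<dots> \<le> 4 * (2 * K * d powr (1 - ?e)) * real (k * s)"
    proof -
      have "?q \<le> d powr (1 - ?e)" using d \<Delta> by (intro powr_mono) auto
      then have "2 * K * ?q \<le> 2 * K * d powr (1 - ?e)" using K by (intro mult_left_mono) auto
      then show ?thesis using m(2) by (intro mult_right_mono mult_left_mono) auto
    qed
    also have "\<dots> < ?c * real t" using few by simp
    finally have "real (4 * k * m * s) < real (card Z)" using that by linarith
    then show ?thesis by (simp only: of_nat_less_iff)
  qed
  have multU: "card {u \<in> ?U \<union> ?U'. v \<in> X u} \<le> k" for v
    by (rule order.trans[OF card_mono mult[of v]]) (use Psub in auto)
  have finU: "finite ?U" "finite ?U'" by (simp_all add: part_def)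
  define Q where "Q = {(u, v) \<in> ?U \<times> ?U'. u \<noteq> v \<and> anticomplete E (X u) (X v)}"
  have many: "card ?U * card ?U' \<le> 4 * m * card Q"
    unfolding Q_def
    by (rule many_anticomplete_pairs[OF E _ m(3) finU Xsmall multU Kpair])
       (use big[OF U] big[OF U'] in auto)
  \<comment> \<open>Forgetting the large projections leaves at most \<open>(N + 1) ^ (s * t)\<close> families for the union bound.\<close>
  define X' where "X' = restrict (\<lambda>u. if card (X u) \<le> s then X u else {}) {1..t}"
  have X'Fam: "X' \<in> PiE {1..t} (\<lambda>_. {A. A \<subseteq> {..<N} \<and> card A \<le> s})"
    using X by (auto simp: X'_def)
  let ?Z = "anticomplete_pairs E X' (?P i) (?P j)"
  have QZ: "(\<lambda>(u, v). {u, v}) ` Q \<subseteq> ?Z"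
  proof clarify
    fix u v assume uv: "(u, v) \<in> Q"
    have "X' u = X u" if "u \<in> ?U \<union> ?U'" for u
      using Xsmall[OF that] that Psub by (auto simp: X'_def small_sets_def)
    then have "X' u = X u" "X' v = X v" using uv by (auto simp: Q_def)
    moreover have "X u \<noteq> {}" "X v \<noteq> {}" using uv X[of u] X[of v] Psub by (auto simp: Q_def)
    ultimately show "{u, v} \<in> ?Z" using uv unfolding Q_def anticomplete_pairs_def mem_Collect_eq
      by (intro exI[of _ u] exI[of _ v]) auto
  qed
  have finZ: "finite ?Z"
    by (rule finite_subset[OF anticomplete_pairs_subset]) (simp add: finite_pairs_between part_def)
  have "finite Q" unfolding Q_def
    by (rule finite_subset[of _ "?U \<times> ?U'"]) (use finU in auto)
  then have "card Q \<le> 2 * card ((\<lambda>(u, v). {u, v}) ` Q)"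
    by (rule card_doubleton_image_ge) (auto simp: Q_def)
  also have "\<dots> \<le> 2 * card ?Z" using card_mono[OF finZ QZ] by simp
  finally have "card Q \<le> 2 * card ?Z" .
  then have "4 * m * card Q \<le> 4 * m * (2 * card ?Z)" by (rule mult_left_mono) simp
  with many have "card ?U * card ?U' \<le> 4 * m * (2 * card ?Z)" by (rule order.trans)
  then have "real (card ?U * card ?U') \<le> real (4 * m * (2 * card ?Z))" by (simp only: of_nat_le_iff)
  then have "real (card ?U) * real (card ?U') \<le> 8 * real m * real (card ?Z)" by simp
  moreover have "(?c * real t) * (?c * real t) \<le> real (card ?U) * real (card ?U')"
    using U U' \<kappa> \<epsilon> by (intro mult_mono) auto
  ultimately have "(?c * real t) * (?c * real t) \<le> 8 * real m * real (card ?Z)" by linarith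
  also have "\<dots> \<le> 8 * (2 * K * ?q) * real (card ?Z)"
    using m(2) by (intro mult_right_mono mult_left_mono) auto
  finally have "?c\<^sup>2 * (real t)\<^sup>2 \<le> 16 * K * ?q * real (card ?Z)"
    by (simp add: power2_eq_square mult_ac)
  then have dens: "?c\<^sup>2 / (16 * K * ?q) \<le> real (card ?Z) / (real t)\<^sup>2"
    using K d t0 by (simp add: field_simps)
  have ep: "epowr d (D i j) = d powr \<Delta>" by (simp add: epowr_def D\<Delta>)
  have td: "1 \<le> real t * d powr \<Delta>"
  proof -
    have "0 \<le> \<Delta>" using \<Delta>(1) xy0 by (smt (verit) zero_le_power2)
    then have "1 \<le> d powr \<Delta>" using d by (intro ge_one_powr_ge_zero) auto
    moreover have "1 \<le> real t" using t0 by simp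
    ultimately show ?thesis by (metis mult_1 mult_mono' zero_le_one)
  qed
  have flo: "real t * d powr \<Delta> / 2 \<le> real_of_int \<lfloor>real t * epowr d (D i j)\<rfloor>"
  proof -
    have "1 \<le> \<lfloor>z\<rfloor> \<Longrightarrow> z / 2 \<le> real_of_int \<lfloor>z\<rfloor>" for z :: real by linarith
    then show ?thesis unfolding ep using td by (simp add: le_floor_iff)
  qed
  have "?c\<^sup>2 * real t * d powr ?e / (32 * K) = ?c\<^sup>2 / (16 * K * ?q) * (real t * d powr \<Delta> / 2)"
    using d K by (simp add: powr_diff field_simps)
  also have "\<dots> \<le> real (card ?Z) / (real t)\<^sup>2 * real_of_int \<lfloor>real t * epowr d (D i j)\<rfloor>"
    by (rule mult_mono[OF dens flo]) auto
  finally have large: "?c\<^sup>2 * real t * d powr ?e / (32 * K) \<le>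
    real (card ?Z) / (real t)\<^sup>2 * real_of_int \<lfloor>real t * epowr d (D i j)\<rfloor>" .
  have "edges H \<inter> ?Z = {}"
  proof (rule ccontr)
    assume "edges H \<inter> ?Z \<noteq> {}"
    then obtain u v where uv: "{u, v} \<in> edges H" "u \<in> ?P i" "v \<in> ?P j" "X' u \<noteq> {}" "X' v \<noteq> {}"
        "anticomplete E (X' u) (X' v)"
      unfolding anticomplete_pairs_def by blast
    have "u \<in> {1..t}" "v \<in> {1..t}" using uv Psub by auto
    moreover from this have "X' u = X u" "X' v = X v"
      using uv(4,5) by (auto simp: X'_def split: if_splits)
    ultimately show False using edge uv(1,6) by simp
  qed
  then show ?thesis using X'Fam ij large by blast
qed

text \<open>The witnesses \<open>(X, i, j)\<close> range over a set independent of \<open>H\<close>,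
  with at most \<open>(N + 1) ^ (s * t)\<close> families and \<open>r\<^sup>2\<close> index pairs.
  By \<open>card_class_avoiding_le\<close> each serves at most a fraction
  \<open>exp (- \<Lambda>)\<close> of the class.\<close>

lemma card_minors_le:
  assumes \<sigma>: "weight_vector r \<sigma>" and N: "0 < N"
    and avoid: "\<And>H. H \<in> graph_class r \<sigma> D t d \<Longrightarrow> is_minor H (blowup N k E) \<Longrightarrow>
      \<exists>X\<in>PiE {1..t} (\<lambda>_. {A. A \<subseteq> {..<N} \<and> card A \<le> s}). \<exists>i\<in>{1..r}. \<exists>j\<in>{i..r}.
      \<Lambda> \<le> real (card (anticomplete_pairs E X (part r \<sigma> t i) (part r \<sigma> t j))) / (real t)\<^sup>2 *
        real_of_int \<lfloor>real t * epowr d (D i j)\<rfloor> \<and>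
      edges H \<inter> anticomplete_pairs E X (part r \<sigma> t i) (part r \<sigma> t j) = {}"
  shows "real (card {H \<in> graph_class r \<sigma> D t d. is_minor H (blowup N k E)}) \<le>
    (real r)\<^sup>2 * (real N + 1) ^ (s * t) * exp (- \<Lambda>) * real (card (graph_class r \<sigma> D t d))"
proof -
  let ?C = "graph_class r \<sigma> D t d" and ?F = "PiE {1..t} (\<lambda>_. {A. A \<subseteq> {..<N} \<and> card A \<le> s})"
  let ?Z = "\<lambda>X i j. anticomplete_pairs E X (part r \<sigma> t i) (part r \<sigma> t j)"
  define I where "I = {(X, i, j). X \<in> ?F \<and> i \<in> {1..r} \<and> j \<in> {i..r} \<and>
    \<Lambda> \<le> real (card (?Z X i j)) / (real t)\<^sup>2 * real_of_int \<lfloor>real t * epowr d (D i j)\<rfloor>}"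
  have "finite ({1..t} :: nat set)" "finite {A. A \<subseteq> {..<N} \<and> card A \<le> s}" by simp_all
  then have finF: "finite ?F" by (simp add: finite_PiE)
  have Isub: "I \<subseteq> ?F \<times> {1..r} \<times> {1..r}" by (auto simp: I_def)
  then have finI: "finite I" using finF by (auto intro: finite_subset)
  have "card ?F = card {A. A \<subseteq> {..<N} \<and> card A \<le> s} ^ t" by (simp add: card_PiE)
  also have "\<dots> \<le> ((N + 1) ^ s) ^ t"
    using card_small_subsets_le[of "{..<N}" s] by (intro power_mono) auto
  finally have cF: "card ?F \<le> (N + 1) ^ (s * t)" by (simp add: power_mult)
  have "card I \<le> card (?F \<times> {1..r} \<times> {1..r})"
    by (rule card_mono[OF _ Isub]) (use finF in simp)
  also have "\<dots> = card ?F * r\<^sup>2" by (simp add: card_cartesian_product power2_eq_square)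
  also have "\<dots> \<le> (N + 1) ^ (s * t) * r\<^sup>2" by (rule mult_right_mono[OF cF]) simp
  finally have "real (card I) \<le> real ((N + 1) ^ (s * t) * r\<^sup>2)" by (simp only: of_nat_le_iff)
  then have cI: "real (card I) \<le> (real r)\<^sup>2 * (real N + 1) ^ (s * t)" by (simp add: mult_ac add.commute)
  have "{H \<in> ?C. is_minor H (blowup N k E)} \<subseteq> (\<Union>(X, i, j)\<in>I. {H \<in> ?C. edges H \<inter> ?Z X i j = {}})"
  proof
    fix H assume "H \<in> {H \<in> ?C. is_minor H (blowup N k E)}"
    then have H: "H \<in> ?C" "is_minor H (blowup N k E)" by auto
    from avoid[OF this] obtain X i j where "(X, i, j) \<in> I" "edges H \<inter> ?Z X i j = {}"
      unfolding I_def by blast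
    then show "H \<in> (\<Union>(X, i, j)\<in>I. {H \<in> ?C. edges H \<inter> ?Z X i j = {}})" using H(1) by blast
  qed
  then have "card {H \<in> ?C. is_minor H (blowup N k E)} \<le> card (\<Union>(X, i, j)\<in>I. {H \<in> ?C. edges H \<inter> ?Z X i j = {}})"
    by (rule card_mono[rotated]) (use finI finite_graph_class in auto)
  also have "\<dots> \<le> (\<Sum>(X, i, j)\<in>I. card {H \<in> ?C. edges H \<inter> ?Z X i j = {}})"
    using card_UN_le[OF finI] by (simp add: case_prod_unfold)
  finally have "real (card {H \<in> ?C. is_minor H (blowup N k E)}) \<le>
      real (\<Sum>(X, i, j)\<in>I. card {H \<in> ?C. edges H \<inter> ?Z X i j = {}})" by (simp only: of_nat_le_iff)
  also have "\<dots> = (\<Sum>(X, i, j)\<in>I. real (card {H \<in> ?C. edges H \<inter> ?Z X i j = {}}))"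
    by (simp add: case_prod_unfold)
  also have "\<dots> \<le> (\<Sum>a\<in>I. exp (- \<Lambda>) * real (card ?C))"
  proof (rule sum_mono, clarify)
    fix X i j assume a: "(X, i, j) \<in> I"
    then have ij: "i \<in> {1..r}" "j \<in> {i..r}"
      and \<Lambda>: "\<Lambda> \<le> real (card (?Z X i j)) / (real t)\<^sup>2 * real_of_int \<lfloor>real t * epowr d (D i j)\<rfloor>"
      by (auto simp: I_def)
    have "?Z X i j \<subseteq> pairs_between (part r \<sigma> t i) (part r \<sigma> t j)"
      by (rule anticomplete_pairs_subset)
    from card_class_avoiding_le[OF \<sigma> ij this, of D d]
    have "real (card {H \<in> ?C. edges H \<inter> ?Z X i j = {}}) \<le>
      exp (- (real (card (?Z X i j)) / (real t)\<^sup>2 * real_of_int \<lfloor>real t * epowr d (D i j)\<rfloor>)) * real (card ?C)" .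
    also have "\<dots> \<le> exp (- \<Lambda>) * real (card ?C)"
      using \<Lambda> by (intro mult_right_mono) auto
    finally show "real (card {H \<in> ?C. edges H \<inter> ?Z X i j = {}}) \<le> exp (- \<Lambda>) * real (card ?C)" .
  qed
  also have "\<dots> = real (card I) * (exp (- \<Lambda>) * real (card ?C))" by simp
  also have "\<dots> \<le> ((real r)\<^sup>2 * (real N + 1) ^ (s * t)) * (exp (- \<Lambda>) * real (card ?C))"
    by (rule mult_right_mono[OF cI]) simp
  finally show ?thesis by (simp add: mult.assoc)
qed

section \<open>Choice of parameters\<close>

text \<open>\<open>K\<close> is of the order of a power of \<open>ln d\<close> and is compared with
  powers of \<open>d\<close>. The conditions say in turn that the base is small against the host,
  that it is large enough for its density, that rounding the parts is harmless, that
  \<open>K\<close> is at least 1, that the multiplicity is small, and that the exponent in the union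
  bound wins.\<close>

lemma eventually_parameters:
  fixes l \<epsilon> a b c e f C :: real
  assumes "0 < l" "0 < \<epsilon>" "0 < a" "0 < b" "0 < c" "0 < e" "0 < f" "f < 1"
  defines "K \<equiv> \<lambda>d. (2 * (sqrt (ln d / l) / \<epsilon>) + 2) * ln (d + 2)"
  shows "\<forall>\<^sub>F d in at_top. 1 < d \<and> d powr f + 1 \<le> a * d * sqrt (ln d / l) \<and> b \<le> d powr f \<and>
    2 \<le> a * d \<and> 1 \<le> K d \<and> 8 * K d * (ln d / l) / \<epsilon> < c * d powr (e / 2) \<and>
    32 * K d * (C + K d) \<le> c\<^sup>2 * d powr e"
proof -
  have "\<forall>\<^sub>F d in at_top. (1 :: real) < d" by real_asymp
  moreover have "\<forall>\<^sub>F d in at_top. d powr f + 1 \<le> a * d * sqrt (ln d / l)"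
    using assms(1-8) by real_asymp
  moreover have "\<forall>\<^sub>F d in at_top. b \<le> d powr f" using assms(1-8) by real_asymp
  moreover have "\<forall>\<^sub>F d in at_top. 2 \<le> a * d" using assms(1-8) by real_asymp
  moreover have "\<forall>\<^sub>F d in at_top. 1 \<le> K d" unfolding K_def using assms(1-8) by real_asymp
  moreover have "\<forall>\<^sub>F d in at_top. 8 * K d * (ln d / l) / \<epsilon> < c * d powr (e / 2)"
    unfolding K_def using assms(1-8) by real_asymp
  moreover have "\<forall>\<^sub>F d in at_top. 32 * K d * (C + K d) \<le> c\<^sup>2 * d powr e"
    unfolding K_def using assms(1-8) by real_asymp
  ultimately show ?thesis by eventually_elim simp
qed

text \<open>The logarithm is at least \<open>p\<close>, hence at least \<open>p\<^sup>2\<close>. The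
  bound shows that the supremum \<open>alpha_const\<close> is over a bounded set, and it turns a
  relative loss in density into an absolute one.\<close>

lemma alpha_objective_le:
  assumes "0 < p" "p < 1"
  shows "p / (2 * sqrt (ln (1 / (1 - p)))) \<le> 1 / 2"
proof -
  have "ln (1 - p) \<le> - p" using ln_le_minus_one[of "1 - p"] assms by simp
  then have l: "p \<le> ln (1 / (1 - p))" using assms by (simp add: ln_div)
  have "p * p \<le> p * 1" using assms by (intro mult_left_mono) auto
  then have "p\<^sup>2 \<le> ln (1 / (1 - p))" using l by (simp add: power2_eq_square)
  then have "p \<le> sqrt (ln (1 / (1 - p)))" by (rule real_le_rsqrt)
  then show ?thesis using assms l by (simp add: divide_le_eq)
qed

lemma exists_near_alpha:
  assumes "0 < \<delta>"
  obtains p where "0 < p" "p < 1" "alpha_const - \<delta> < p / (2 * sqrt (ln (1 / (1 - p))))"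
proof -
  have bdd: "bdd_above ((\<lambda>p. p / (2 * sqrt (ln (1 / (1 - p))))) ` {0<..<1})"
    by (rule bdd_aboveI2[of _ _ "1 / 2"]) (use alpha_objective_le in auto)
  have ne: "{0<..<1 :: real} \<noteq> {}" using dense[of "0 :: real" 1] by auto
  have "alpha_const - \<delta> < alpha_const" using assms by simp
  then have "\<exists>p\<in>{0<..<1}. alpha_const - \<delta> < p / (2 * sqrt (ln (1 / (1 - p))))"
    using less_cSUP_iff[OF ne bdd] by (simp only: alpha_const_def[symmetric])
  then show ?thesis using that by auto
qed

text \<open>The threshold for \<open>d\<close> must not depend on \<open>r\<close>; this bounds the
  number of index pairs in terms of \<open>\<epsilon>\<close>.\<close>

lemma length_le_inverse:
  assumes "weight_vector r \<sigma>" "\<And>i. i \<in> {1..r} \<Longrightarrow> \<epsilon> < \<sigma> i" "0 < \<epsilon>"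
  shows "real r \<le> 1 / \<epsilon>"
proof -
  have "real r * \<epsilon> = (\<Sum>i=1..r. \<epsilon>)" by simp
  also have "\<dots> \<le> (\<Sum>i=1..r. \<sigma> i)" by (rule sum_mono) (use assms(2) in \<open>auto intro: less_imp_le\<close>)
  also have "\<dots> = 1" using assms(1) by (simp add: weight_vector_def)
  finally show ?thesis using assms(3) by (simp add: field_simps)
qed

text \<open>The three summands in the bound on \<open>\<Lambda>\<close> pay, in this order, for the
  index pairs, for the target proportion and for the families of projections.\<close>

lemma union_bound_le:
  fixes \<epsilon> K C :: real
  assumes \<epsilon>: "0 < \<epsilon>" "\<epsilon> \<le> 1" and r: "real r \<le> 1 / \<epsilon>" and K: "real s * ln (real N + 1) \<le> K"
    and t: "1 \<le> real t" and \<Lambda>: "real t * (2 * ln (1 / \<epsilon>) + ln 2 + K) \<le> \<Lambda>"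
  shows "(real r)\<^sup>2 * (real N + 1) ^ (s * t) * exp (- \<Lambda>) \<le> 2 powr (- real t)"
proof -
  have l: "0 \<le> ln (1 / \<epsilon>)" using \<epsilon> by simp
  have "(real r)\<^sup>2 \<le> (1 / \<epsilon>)\<^sup>2" using r by (intro power_mono) auto
  also have "\<dots> = exp (2 * ln (1 / \<epsilon>))"
    using \<epsilon> by (simp add: exp_of_nat_mult[of 2, simplified])
  also have "\<dots> \<le> exp (real t * (2 * ln (1 / \<epsilon>)))"
    using mult_right_mono[OF t, of "2 * ln (1 / \<epsilon>)"] l by simp
  finally have 1: "(real r)\<^sup>2 \<le> exp (real t * (2 * ln (1 / \<epsilon>)))" .
  have "(real N + 1) ^ (s * t) = exp (real (s * t) * ln (real N + 1))"
    by (subst exp_of_nat_mult) simp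
  also have "\<dots> = exp (real t * (real s * ln (real N + 1)))" by (simp add: mult_ac)
  also have "\<dots> \<le> exp (real t * K)" using K by (simp add: mult_left_mono)
  finally have 2: "(real N + 1) ^ (s * t) \<le> exp (real t * K)" .
  have "(real r)\<^sup>2 * (real N + 1) ^ (s * t) * exp (- \<Lambda>) \<le>
      exp (real t * (2 * ln (1 / \<epsilon>))) * exp (real t * K) * exp (- (real t * (2 * ln (1 / \<epsilon>) + ln 2 + K)))"
    by (intro mult_mono 1 2) (use \<Lambda> in auto)
  also have "\<dots> = exp (- (real t * ln 2))" unfolding exp_add[symmetric] by (simp add: algebra_simps)
  also have "\<dots> = 2 powr (- real t)" by (simp add: powr_def)
  finally show ?thesis .
qed

text \<open>The density is \<open>k * card E / N\<close>, about \<open>p / 2\<close> times the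
  number \<open>N * k\<close> of vertices. The loss \<open>7 * \<kappa>\<close> collects
  \<open>\<kappa>\<close> from the edge density of \<open>E\<close>, \<open>\<kappa>\<close> from
  \<open>N - 1\<close> against \<open>N\<close>, and \<open>5 * \<kappa>\<close> from
  \<open>N * k\<close> against \<open>Y\<close>.\<close>

lemma blowup_density_ge:
  fixes p \<kappa> :: real
  assumes p: "0 < p" "p < 1" and \<kappa>: "0 < \<kappa>" "\<kappa> \<le> 1 / 8" and N: "1 / (\<kappa> * p) \<le> real N"
    and E: "E \<subseteq> pairs_between {..<N} {..<N}"
      "(p - 1 / (real N + 1)) * real (N choose 2) \<le> real (card E)"
    and Y: "0 < Y" "(1 - 5 * \<kappa>) * Y \<le> real (N * k)"
  shows "(1 - 7 * \<kappa>) * (p / 2) * Y \<le>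
    real (card (edges (blowup N k E))) / real (card (verts (blowup N k E)))"
proof -
  have 1: "1 \<le> \<kappa> * p * real N" using N p \<kappa> by (simp add: field_simps)
  also have "\<dots> \<le> \<kappa> * 1 * real N" using p \<kappa> by (intro mult_right_mono mult_left_mono) auto
  finally have 2: "1 \<le> \<kappa> * real N" by simp
  have N0: "0 < real N" using 1 by (cases "N = 0") auto
  have "\<kappa> * p * real N \<le> \<kappa> * p * (real N + 1)" using p \<kappa> by (intro mult_left_mono) auto
  with 1 have "1 \<le> \<kappa> * p * (real N + 1)" by linarith
  then have "1 / (real N + 1) \<le> \<kappa> * p" by (subst pos_divide_le_eq) auto
  then have A: "(1 - \<kappa>) * p \<le> p - 1 / (real N + 1)" by (simp add: algebra_simps)
  have "0 \<le> (1 - \<kappa>) * p" using \<kappa> p by simp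
  with A have B: "0 \<le> p - 1 / (real N + 1)" by linarith
  have "real N * ((1 - \<kappa>) * real N) / 2 \<le> real N * (real N - 1) / 2"
    using 2 N0 by (intro divide_right_mono mult_left_mono) (auto simp: algebra_simps)
  also have "\<dots> = real (N choose 2)"
    using N0 by (simp add: choose_two real_of_nat_div of_nat_diff)
  finally have "((1 - \<kappa>) * p) * (real N * ((1 - \<kappa>) * real N) / 2) \<le>
      (p - 1 / (real N + 1)) * real (N choose 2)"
    using A B \<kappa> by (intro mult_mono) auto
  also note E(2)
  finally have "((1 - \<kappa>) * p) * (real N * ((1 - \<kappa>) * real N) / 2) \<le> real (card E)" .
  then have cE: "(1 - \<kappa>)\<^sup>2 * (p / 2) * (real N)\<^sup>2 \<le> real (card E)"
    by (simp add: power2_eq_square mult_ac)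
  have "0 < (1 - 5 * \<kappa>) * Y" using \<kappa> Y by simp
  then have Nk: "0 < real (N * k)" using Y by linarith
  then have k0: "0 < real k" by (cases "k = 0") auto
  have dens: "real (card (edges (blowup N k E))) / real (card (verts (blowup N k E))) =
      real k * real (card E) / real N"
  proof -
    have "card (verts (blowup N k E)) = N * k" by (simp add: blowup_def)
    then show ?thesis
      unfolding card_edges_blowup[OF E(1)] using k0 by (simp add: power2_eq_square)
  qed
  have "(1 - 7 * \<kappa>) \<le> (1 - 5 * \<kappa>) * (1 - \<kappa>)\<^sup>2"
  proof -
    have "(1 - 5 * \<kappa>) * (1 - \<kappa>)\<^sup>2 - (1 - 7 * \<kappa>) = \<kappa>\<^sup>2 * (11 - 5 * \<kappa>)"
      by (simp add: power2_eq_square algebra_simps)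
    moreover have "0 \<le> \<kappa>\<^sup>2 * (11 - 5 * \<kappa>)" using \<kappa> by simp
    ultimately show ?thesis by linarith
  qed
  then have "(1 - 7 * \<kappa>) * ((p / 2) * Y) \<le> ((1 - 5 * \<kappa>) * (1 - \<kappa>)\<^sup>2) * ((p / 2) * Y)"
    using p Y by (intro mult_right_mono) auto
  also have "\<dots> = (1 - \<kappa>)\<^sup>2 * (p / 2) * ((1 - 5 * \<kappa>) * Y)" by simp
  also have "\<dots> \<le> (1 - \<kappa>)\<^sup>2 * (p / 2) * real (N * k)"
    using Y p by (intro mult_left_mono) auto
  also have "\<dots> = real k * ((1 - \<kappa>)\<^sup>2 * (p / 2) * (real N)\<^sup>2) / real N"
    using N0 by (simp add: power2_eq_square)
  also have "\<dots> \<le> real k * real (card E) / real N"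
    using cE N0 by (intro divide_right_mono mult_left_mono) auto
  finally show ?thesis unfolding dens by (simp add: mult.assoc)
qed

theorem theorem1p13:
  fixes \<epsilon> :: real
  assumes "\<epsilon> > 0"
  shows "\<exists>D\<^sub>0 :: real. \<forall>(t :: nat) (d :: real) (r :: nat) (\<sigma> :: nat \<Rightarrow> real) (D :: nat \<Rightarrow> nat \<Rightarrow> ereal).
    d > 1 \<longrightarrow> d > D\<^sub>0 \<longrightarrow> real t > d \<longrightarrow>
    weight_vector r \<sigma> \<longrightarrow> (\<forall>i\<in>{1..r}. \<sigma> i > \<epsilon>) \<longrightarrow>
    exponent_matrix r D \<longrightarrow> gamma_weight r \<sigma> D \<ge> \<epsilon> \<longrightarrow>
    real (card {H \<in> graph_class r \<sigma> D t d.
        \<not> minor_threshold H \<ge>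
          ereal ((alpha_const - \<epsilon>) * gamma_weight r \<sigma> D * real t * sqrt (ln d))})
      \<le> 2 powr (- real t) * real (card (graph_class r \<sigma> D t d))"
proof (cases "\<epsilon> \<le> 1")
  case False
  \<comment> \<open>For \<open>\<epsilon> > 1\<close> the claim is vacuous, because gamma is at most
    1.\<close>
  have "\<not> gamma_weight r \<sigma> D \<ge> \<epsilon>" if "weight_vector r \<sigma>" "exponent_matrix r D" for r \<sigma> D
    using gamma_weight_le_1[OF that] False by simp
  then show ?thesis by blast
next
  case True
  note \<epsilon> = assms True
  \<comment> \<open>The density loss is \<open>7 * \<kappa>\<close> times a quantity of at most
    \<open>1 / 2\<close>, hence at most \<open>7 * \<epsilon> / 16\<close>. This fits into the
    \<open>\<epsilon> / 2\<close> left over by the choice of \<open>p\<close>.\<close>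
  define \<kappa> where "\<kappa> = \<epsilon> / 8"
  define e where "e = (\<kappa> * \<epsilon>)\<^sup>2"
  \<comment> \<open>The base will have about \<open>d powr f\<close> vertices with
    \<open>1 - e < f < 1\<close>. Being well below \<open>d\<close> makes it small against the host;
    exceeding \<open>d powr (1 - e)\<close> by a factor \<open>d powr (e / 2)\<close> keeps the
    number \<open>k\<close> of copies small enough for \<open>few\<close>.\<close>
  define f where "f = 1 - e / 2"
  define c where "c = \<kappa> * \<epsilon> / 4"
  define C where "C = 2 * ln (1 / \<epsilon>) + ln 2"
  have \<kappa>: "0 < \<kappa>" "\<kappa> \<le> 1 / 8" using \<epsilon> by (simp_all add: \<kappa>_def)
  have "\<kappa> * \<epsilon> \<le> 1 * 1" using \<kappa> \<epsilon> by (intro mult_mono) auto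
  then have "e \<le> 1" using \<kappa> \<epsilon> by (simp add: e_def power_le_one)
  moreover have "0 < e" using \<kappa> \<epsilon> by (simp add: e_def)
  ultimately have ef: "0 < e" "0 < f" "f < 1" by (simp_all add: f_def)
  have c: "0 < c" "0 < \<kappa> * \<epsilon>" using \<kappa> \<epsilon> by (simp_all add: c_def)
  obtain p where p: "0 < p" "p < 1" and alpha: "alpha_const - \<epsilon> / 2 < p / (2 * sqrt (ln (1 / (1 - p))))"
    using exists_near_alpha[of "\<epsilon> / 2"] \<epsilon> by auto
  define l where "l = ln (1 / (1 - p))"
  have l: "0 < l" "exp (- l) = 1 - p" using p by (simp_all add: l_def ln_div)
  define K where "K d = (2 * (sqrt (ln d / l) / \<epsilon>) + 2) * ln (d + 2)" for d
  have b: "0 < 1 / (\<kappa> * p)" using \<kappa> p by simp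
  from eventually_parameters[OF l(1) \<epsilon>(1) c(2) b c(1) ef, of C, folded K_def]
  obtain D\<^sub>0 where D\<^sub>0: "1 < d" "d powr f + 1 \<le> \<kappa> * \<epsilon> * d * sqrt (ln d / l)" "1 / (\<kappa> * p) \<le> d powr f"
      "2 \<le> \<kappa> * \<epsilon> * d" "1 \<le> K d" "8 * K d * (ln d / l) / \<epsilon> < c * d powr (e / 2)"
      "32 * K d * (C + K d) \<le> c\<^sup>2 * d powr e" if "D\<^sub>0 \<le> d" for d
    unfolding eventually_at_top_linorder by blast
  show ?thesis
  proof (intro exI[of _ D\<^sub>0] allI impI)
    fix t :: nat and d :: real and r :: nat and \<sigma> :: "nat \<Rightarrow> real" and D :: "nat \<Rightarrow> nat \<Rightarrow> ereal"
    assume "1 < d" and dD: "D\<^sub>0 < d" and td: "d < real t"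
      and \<sigma>: "weight_vector r \<sigma>" and "\<forall>i\<in>{1..r}. \<epsilon> < \<sigma> i"
      and D: "exponent_matrix r D" and \<gamma>: "\<epsilon> \<le> gamma_weight r \<sigma> D"
    then have \<sigma>\<epsilon>: "\<And>i. i \<in> {1..r} \<Longrightarrow> \<epsilon> < \<sigma> i" by blast
    note d = D\<^sub>0[OF less_imp_le[OF dD]]
    \<comment> \<open>This makes \<open>1 - p\<close> to the power \<open>L\<^sup>2\<close> equal to
      \<open>1 / d\<close>, the non-adjacency probability of two disjoint sets of size
      \<open>L\<close>.\<close>
    define L where "L = sqrt (ln d / l)"
    define N where "N = nat \<lceil>d powr f\<rceil>"
    define s where "s = nat \<lfloor>L / \<epsilon>\<rfloor>"
    define Y where "Y = gamma_weight r \<sigma> D * real t * L"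
    \<comment> \<open>The host gets between \<open>(1 - 5 * \<kappa>) * Y\<close> and
      \<open>(1 - 4 * \<kappa>) * Y\<close> vertices. The upper bound gives every minor its margin
      below gamma, the lower one gives the density. Rounding \<open>k\<close> down costs at most
      \<open>N\<close> vertices, and \<open>N \<le> \<kappa> * Y\<close>.\<close>
    define k where "k = nat \<lfloor>(1 - 4 * \<kappa>) * Y / real N\<rfloor>"
    let ?K = "K d"
    have L: "0 < L" "l * L\<^sup>2 = ln d" "L\<^sup>2 = ln d / l" using d(1) l by (simp_all add: L_def)
    have t: "1 \<le> real t" using td d(1) by simp
    have \<gamma>1: "gamma_weight r \<sigma> D \<le> 1" by (rule gamma_weight_le_1[OF \<sigma> D])
    have Y: "0 < Y" "Y \<le> real t * L"
      using \<gamma> \<gamma>1 \<epsilon> t L by (simp_all add: Y_def mult_left_le_one_le mult.assoc)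
    have df: "0 < d powr f" using d(1) by simp
    then have N: "d powr f \<le> real N" "real N \<le> d powr f + 1" unfolding N_def by linarith+
    have N0: "0 < N" using N(1) df by (cases "N = 0") auto
    have NY: "real N \<le> \<kappa> * Y"
    proof -
      have "\<kappa> * \<epsilon> * d * L \<le> \<kappa> * gamma_weight r \<sigma> D * real t * L"
        using \<gamma> td d(1) \<kappa> \<epsilon> L by (intro mult_mono) auto
      then show ?thesis using N(2) d(2) by (simp add: Y_def L_def mult.assoc)
    qed
    have Nk: "real (N * k) \<le> (1 - 4 * \<kappa>) * Y" "(1 - 5 * \<kappa>) * Y \<le> real (N * k)"
    proof -
      have "0 \<le> (1 - 4 * \<kappa>) * Y / real N" using \<kappa> Y by simp
      then have k: "real k \<le> (1 - 4 * \<kappa>) * Y / real N" "(1 - 4 * \<kappa>) * Y / real N - 1 \<le> real k"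
        unfolding k_def by linarith+
      show "real (N * k) \<le> (1 - 4 * \<kappa>) * Y" using k(1) N0 by (simp add: field_simps)
      have "(1 - 4 * \<kappa>) * Y - real N \<le> real (N * k)" using k(2) N0 by (simp add: field_simps)
      then show "(1 - 5 * \<kappa>) * Y \<le> real (N * k)" using NY by (simp add: algebra_simps)
    qed
    have "0 \<le> L / \<epsilon>" using L \<epsilon> by simp
    then have s: "real s \<le> L / \<epsilon>" "\<And>n. real n \<le> L / \<epsilon> \<Longrightarrow> n \<le> s"
      unfolding s_def by (simp_all add: le_nat_floor)
    have Ns: "(2 * real s + 2) * ln (real N + 1) \<le> ?K"
    proof -
      have "d powr f \<le> d powr 1" using d(1) ef by (intro powr_mono) auto
      then have "ln (real N + 1) \<le> ln (d + 2)" using N(2) d(1) by simp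
      then show ?thesis unfolding K_def L_def[symmetric]
        using s(1) d(1) by (intro mult_mono) auto
    qed
    obtain E where E: "E \<subseteq> pairs_between {..<N} {..<N}" "spreads_nonedges {..<N} s (1 - p) ?K E"
        "(p - 1 / (real N + 1)) * real (N choose 2) \<le> real (card E)"
      using exists_spreads_nonedges[OF p, of "{..<N}" s ?K] Ns N0 by auto
    let ?G = "blowup N k E" and ?C = "graph_class r \<sigma> D t d"
    let ?bound = "(alpha_const - \<epsilon>) * gamma_weight r \<sigma> D * real t * sqrt (ln d)"
    have dense: "?bound \<le> real (card (edges ?G)) / real (card (verts ?G))"
    proof -
      let ?a = "p / (2 * sqrt l)"
      have "\<kappa> * ?a \<le> \<kappa> * (1 / 2)"
        using alpha_objective_le[OF p] \<kappa> by (intro mult_left_mono) (auto simp: l_def)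
      then have "alpha_const - \<epsilon> \<le> (1 - 7 * \<kappa>) * ?a"
        using alpha \<epsilon> by (simp add: l_def[symmetric] algebra_simps \<kappa>_def)
      then have "(alpha_const - \<epsilon>) * (gamma_weight r \<sigma> D * real t * sqrt (ln d)) \<le>
          ((1 - 7 * \<kappa>) * ?a) * (gamma_weight r \<sigma> D * real t * sqrt (ln d))"
        using \<gamma> \<epsilon> d(1) by (intro mult_right_mono) auto
      also have "\<dots> = (1 - 7 * \<kappa>) * (p / 2) * Y"
        by (simp add: Y_def L_def real_sqrt_divide)
      also have "\<dots> \<le> real (card (edges ?G)) / real (card (verts ?G))"
        by (rule blowup_density_ge[OF p \<kappa> _ E(1) E(3) Y(1) Nk(2)]) (use N(1) d(3) in linarith)
      finally show ?thesis by (simp add: mult.assoc)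
    qed
    have "0 < (1 - 5 * \<kappa>) * Y" using \<kappa> Y by simp
    then have "0 < real (N * k)" using Nk(2) by linarith
    then have "verts ?G \<noteq> {}" using N0 by (auto simp: blowup_def lessThan_empty_iff zero_less_mult_iff)
    then have thr: "ereal ?bound \<le> minor_threshold H" if "\<not> is_minor H ?G" for H :: "nat graph"
      using minor_threshold_ge[OF simple_graph_blowup[OF E(1)] _ that dense] by simp
    \<comment> \<open>\<open>k\<close> is at most \<open>t * L / d powr f\<close> and
      \<open>s\<close> at most \<open>L / \<epsilon>\<close>, so the left side is at most
      \<open>t * d powr (- e / 2)\<close> times a factor polynomial in the logarithm up to
      constants.\<close>
    have few: "8 * ?K * d powr (1 - e) * real (k * s) < c * real t"
    proof -
      have "(1 - 4 * \<kappa>) * Y \<le> 1 * Y" using Y \<kappa> by (intro mult_right_mono) auto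
      with Nk(1) have "real (N * k) \<le> real t * L" using Y(2) by linarith
      then have "real k * real N \<le> real t * L" by (simp add: mult.commute)
      then have "real k * d powr f \<le> real t * L"
        using N(1) by (meson mult_left_mono of_nat_0_le_iff order_trans)
      then have "real k \<le> real t * L / d powr f" using df by (simp add: pos_le_divide_eq)
      then have "real k * real s \<le> (real t * L / d powr f) * (L / \<epsilon>)"
        using s(1) L by (intro mult_mono) auto
      also have "\<dots> = real t * (ln d / l) / \<epsilon> / d powr f"
        unfolding L(3)[symmetric] by (simp add: power2_eq_square mult_ac)
      finally have "8 * ?K * d powr (1 - e) * (real k * real s) \<le>
          8 * ?K * d powr (1 - e) * (real t * (ln d / l) / \<epsilon> / d powr f)"
        using d(5) by (intro mult_left_mono) auto
      also have "\<dots> = (8 * ?K * (ln d / l) / \<epsilon>) * (real t * (d powr (1 - e) / d powr f))"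
        by simp
      also have "d powr (1 - e) / d powr f = 1 / d powr (e / 2)"
      proof -
        have "d powr (1 - e) / d powr f = d powr (1 - e - f)" by (rule powr_diff[symmetric])
        also have "1 - e - f = - (e / 2)" by (simp add: f_def)
        finally show ?thesis by (simp add: powr_minus inverse_eq_divide)
      qed
      also have "(8 * ?K * (ln d / l) / \<epsilon>) * (real t * (1 / d powr (e / 2))) <
          (c * d powr (e / 2)) * (real t * (1 / d powr (e / 2)))"
        using d(1,6) t by (intro mult_strict_right_mono) auto
      also have "\<dots> = c * real t" using d(1) by simp
      finally show ?thesis by simp
    qed
    have t2: "2 \<le> \<kappa> * \<epsilon> * real t"
    proof -
      have "\<kappa> * \<epsilon> * d \<le> \<kappa> * \<epsilon> * real t" using td c(2) by (intro mult_left_mono) auto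
      then show ?thesis using d(4) by linarith
    qed
    let ?\<Lambda> = "c\<^sup>2 * real t * d powr e / (32 * ?K)"
    have "real (card {H \<in> ?C. is_minor H ?G}) \<le>
        (real r)\<^sup>2 * (real N + 1) ^ (s * t) * exp (- ?\<Lambda>) * real (card ?C)"
    proof (rule card_minors_le[OF \<sigma> N0])
      fix H assume "H \<in> ?C" "is_minor H ?G"
      moreover from this have "verts H = {1..t}" by (simp add: graph_class_def)
      ultimately show "\<exists>X\<in>PiE {1..t} (\<lambda>_. {A. A \<subseteq> {..<N} \<and> card A \<le> s}). \<exists>i\<in>{1..r}. \<exists>j\<in>{i..r}.
        ?\<Lambda> \<le> real (card (anticomplete_pairs E X (part r \<sigma> t i) (part r \<sigma> t j))) / (real t)\<^sup>2 *
          real_of_int \<lfloor>real t * epowr d (D i j)\<rfloor> \<and>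
        edges H \<inter> anticomplete_pairs E X (part r \<sigma> t i) (part r \<sigma> t j) = {}"
        using minor_avoids_anticomplete_pairs[OF \<sigma> \<sigma>\<epsilon> \<epsilon>(1) D \<gamma> \<kappa> t2 L(1) d(1) l(1) L(2) N0
            E(2)[folded l(2)] d(5) s(2), of k H] Nk(1) few
        by (simp add: c_def e_def Y_def mult.assoc)
    qed
    also have "\<dots> \<le> 2 powr (- real t) * real (card ?C)"
    proof (rule mult_right_mono[OF union_bound_le[OF \<epsilon> length_le_inverse[OF \<sigma> \<sigma>\<epsilon> \<epsilon>(1)] _ t]])
      have "real s * ln (real N + 1) \<le> (2 * real s + 2) * ln (real N + 1)"
        by (intro mult_right_mono) auto
      then show "real s * ln (real N + 1) \<le> ?K" using Ns by linarith
      have "C + ?K \<le> c\<^sup>2 * d powr e / (32 * ?K)" using d(5,7) by (simp add: pos_le_divide_eq mult_ac)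
      then have "real t * (C + ?K) \<le> real t * (c\<^sup>2 * d powr e / (32 * ?K))" by (rule mult_left_mono) simp
      then show "real t * (2 * ln (1 / \<epsilon>) + ln 2 + ?K) \<le> ?\<Lambda>" by (simp add: C_def mult_ac)
    qed simp_all
    finally have bound: "real (card {H \<in> ?C. is_minor H ?G}) \<le> 2 powr (- real t) * real (card ?C)" .
    \<comment> \<open>By \<open>thr\<close>, a member of the class that misses the bound must be a
      minor of \<open>?G\<close>.\<close>
    have "card {H \<in> ?C. \<not> ereal ?bound \<le> minor_threshold H} \<le> card {H \<in> ?C. is_minor H ?G}"
      using thr finite_graph_class by (intro card_mono) auto
    then show "real (card {H \<in> ?C. \<not> ereal ?bound \<le> minor_threshold H}) \<le>
        2 powr (- real t) * real (card ?C)"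
      using bound by linarith
  qed
qed

end
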